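(* Let $\alpha\in(0,1]$ and let $X$ be a super-reflexive Banach space that admits a renorming with modulus of smoothness of power type $1+\alpha$. Let $\omega:(0,\infty)\to(0,\infty)$ be a non-decreasing function such that $\lim_{t\to 0}\omega(t)=0$, $\lim_{t\to\infty}\omega(t)=\infty$, $\lim_{t\to 0}t/\omega(t)=0$, and, for some constant $C_{\mathrm{db}}>1$, $\omega(2t)\le C_{\mathrm{db}}\,\omega(t)$ for all $t\in(0,\infty)$. Then: (i) $\overline{C^{1,\alpha}(X)\cap\mathrm{Lip}(X)\cap\dot C^{0,\omega}(X)}^{\,\dot C^{0,\omega}(X)}=\dot{\mathrm{VC}}^{0,\omega}_{\mathrm{small}}(X)$; (ii) $\overline{C^{1,\alpha}_{\mathrm{bs}}(X)}^{\,\dot C^{0,\omega}(X)}=\dot{\mathrm{VC}}^{0,\omega}(X)$.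
   Context: $X$ admits a renorming with modulus of smoothness of power type $1+\alpha$ if there are an equivalent norm $\|\cdot\|$ on $X$ and a constant $C>0$ with $\|x+h\|^{1+\alpha}+\|x-h\|^{1+\alpha}-2\|x\|^{1+\alpha}\le C\|h\|^{1+\alpha}$ for all $x,h\in X$. A Banach space $X$ is super-reflexive if every Banach space finitely representable in $X$ is reflexive. All function classes consist of real-valued functions on $X$. $\dot C^{0,\omega}(X)$ is the set of $f:X\to\mathbb R$ with $\|f\|_{\dot C^{0,\omega}(X)}:=\sup_{x\ne y}\frac{|f(x)-f(y)|}{\omega(\|x-y\|)}<\infty$. For $x\neq y$ put $\mathrm{osc}^\omega_{(x,y)}(f)=\frac{|f(x)-f(y)|}{\omega(\|x-y\|)}$, and for $\delta>0$ put $\mathrm{osc}^\omega_\delta(f)=\sup\{\mathrm{osc}^\omega_{(x,y)}(f): x,y\in X,\ \|x-y\|=\delta\}$. Define $\dot{\mathrm{VC}}^{0,\omega}_{\mathrm{small}}(X)=\{f\in\dot C^{0,\omega}(X):\lim_{\delta\to0}\mathrm{osc}^\omega_\delta(f)=0\}$, $\dot{\mathrm{VC}}^{0,\omega}_{\mathrm{large}}(X)=\{f\in\dot C^{0,\omega}(X):\lim_{\delta\to\infty}\mathrm{osc}^\omega_\delta(f)=0\}$, $\dot{\mathrm{VC}}^{0,\omega}_{\mathrm{far}}(X)=\{f\in\dot C^{0,\omega}(X):\lim_{\delta\to\infty}\sup_{x\ne y,\ \min(\|x\|,\|y\|)>\delta}\mathrm{osc}^\omega_{(x,y)}(f)=0\}$,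 and $\dot{\mathrm{VC}}^{0,\omega}(X)$ as the intersection of these three sets. $\mathrm{Lip}(X)$ is the set of (not necessarily bounded) Lipschitz functions $X\to\mathbb R$. $C^{1,\alpha}(X)$ is the set of $f:X\to\mathbb R$ that are Fréchet differentiable (over the real scalars) everywhere with $\sup_{x\ne y}\|Df(x)-Df(y)\|_*/\|x-y\|^\alpha<\infty$, where $\|\cdot\|_*$ is the dual norm on $X^*$; $C^{1,\alpha}_{\mathrm{bs}}(X)$ is the subset of those with bounded support (vanishing outside some ball $B(0,R)$). For $\mathcal C\subset\dot C^{0,\omega}(X)$, $\overline{\mathcal C}^{\,\dot C^{0,\omega}(X)}$ is the set of $f\in\dot C^{0,\omega}(X)$ for which there is a sequence $(f_n)\subset\mathcal C$ with $\|f_n-f\|_{\dot C^{0,\omega}(X)}\to0$. *)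

theory Defs
  imports "HOL-Analysis.Analysis"
begin

section \<open>Banach spaces as structures on carrier sets\<close>

text \<open>
  Super-reflexivity of a space quantifies over all Banach spaces, and inside a formula this cannot be
  a quantification over the types of class \<^class>\<open>banach\<close>. The test spaces are therefore structures
  on subsets of a type. The values of the operations outside the carrier are irrelevant.
\<close>

record 'u normed_structure =
  pts :: "'u set"
  vadd :: "'u \<Rightarrow> 'u \<Rightarrow> 'u"
  vzero :: 'u
  vscale :: "real \<Rightarrow> 'u \<Rightarrow> 'u"
  vnorm :: "'u \<Rightarrow> real"

definition vector_structure :: "'u normed_structure \<Rightarrow> bool" where
  "vector_structure Y \<longleftrightarrow>
     vzero Y \<in> pts Y \<and>
     (\<forall>x\<in>pts Y. \<forall>y\<in>pts Y. vadd Y x y \<in> pts Y) \<and>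
     (\<forall>r. \<forall>x\<in>pts Y. vscale Y r x \<in> pts Y) \<and>
     (\<forall>x\<in>pts Y. \<forall>y\<in>pts Y. \<forall>z\<in>pts Y. vadd Y (vadd Y x y) z = vadd Y x (vadd Y y z)) \<and>
     (\<forall>x\<in>pts Y. \<forall>y\<in>pts Y. vadd Y x y = vadd Y y x) \<and>
     (\<forall>x\<in>pts Y. vadd Y x (vzero Y) = x) \<and>
     (\<forall>x\<in>pts Y. vadd Y x (vscale Y (-1) x) = vzero Y) \<and>
     (\<forall>r. \<forall>x\<in>pts Y. \<forall>y\<in>pts Y. vscale Y r (vadd Y x y) = vadd Y (vscale Y r x) (vscale Y r y)) \<and>
     (\<forall>r s. \<forall>x\<in>pts Y. vscale Y (r + s) x = vadd Y (vscale Y r x) (vscale Y s x)) \<and>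
     (\<forall>r s. \<forall>x\<in>pts Y. vscale Y r (vscale Y s x) = vscale Y (r * s) x) \<and>
     (\<forall>x\<in>pts Y. vscale Y 1 x = x)"

definition vdist :: "'u normed_structure \<Rightarrow> 'u \<Rightarrow> 'u \<Rightarrow> real" where
  "vdist Y x y = vnorm Y (vadd Y x (vscale Y (-1) y))"

definition banach_structure :: "'u normed_structure \<Rightarrow> bool" where
  "banach_structure Y \<longleftrightarrow>
     vector_structure Y \<and>
     (\<forall>x\<in>pts Y. vnorm Y x = 0 \<longleftrightarrow> x = vzero Y) \<and>
     (\<forall>r. \<forall>x\<in>pts Y. vnorm Y (vscale Y r x) = \<bar>r\<bar> * vnorm Y x) \<and>
     (\<forall>x\<in>pts Y. \<forall>y\<in>pts Y. vnorm Y (vadd Y x y) \<le> vnorm Y x + vnorm Y y) \<and>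
     (\<forall>s :: nat \<Rightarrow> 'u. range s \<subseteq> pts Y \<longrightarrow>
        (\<forall>e>0. \<exists>N. \<forall>m\<ge>N. \<forall>n\<ge>N. vdist Y (s m) (s n) < e) \<longrightarrow>
        (\<exists>l\<in>pts Y. (\<lambda>n. vdist Y (s n) l) \<longlonglongrightarrow> 0))"

definition vlinear_on :: "'u normed_structure \<Rightarrow> 'u set \<Rightarrow> ('u \<Rightarrow> 'b::real_vector) \<Rightarrow> bool" where
  "vlinear_on Y E T \<longleftrightarrow>
     (\<forall>x\<in>E. \<forall>y\<in>E. T (vadd Y x y) = T x + T y) \<and>
     (\<forall>r. \<forall>x\<in>E. T (vscale Y r x) = r *\<^sub>R T x)"

text \<open>
  A functional is represented by its extension by zero outside the carrier, so that it corresponds to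
  exactly one function.
\<close>

definition dual_structure :: "'u normed_structure \<Rightarrow> ('u \<Rightarrow> real) normed_structure" where
  "dual_structure Y = \<lparr>
     pts = {\<phi>. vlinear_on Y (pts Y) \<phi> \<and> (\<exists>B. \<forall>y\<in>pts Y. \<bar>\<phi> y\<bar> \<le> B * vnorm Y y) \<and>
               (\<forall>y. y \<notin> pts Y \<longrightarrow> \<phi> y = 0)},
     vadd = (\<lambda>\<phi> \<psi> y. \<phi> y + \<psi> y),
     vzero = (\<lambda>y. 0),
     vscale = (\<lambda>r \<phi> y. r * \<phi> y),
     vnorm = (\<lambda>\<phi>. Sup {\<bar>\<phi> y\<bar> | y. y \<in> pts Y \<and> vnorm Y y \<le> 1}) \<rparr>"

definition reflexive_structure :: "'u normed_structure \<Rightarrow> bool" where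
  "reflexive_structure Y \<longleftrightarrow>
     (\<forall>\<Phi>\<in>pts (dual_structure (dual_structure Y)).
        \<exists>y\<in>pts Y. \<forall>\<phi>\<in>pts (dual_structure Y). \<Phi> \<phi> = \<phi> y)"

definition vsubspace :: "'u normed_structure \<Rightarrow> 'u set \<Rightarrow> bool" where
  "vsubspace Y E \<longleftrightarrow>
     E \<subseteq> pts Y \<and> vzero Y \<in> E \<and> (\<forall>x\<in>E. \<forall>y\<in>E. vadd Y x y \<in> E) \<and> (\<forall>r. \<forall>x\<in>E. vscale Y r x \<in> E)"

definition finite_dim_vsubspace :: "'u normed_structure \<Rightarrow> 'u set \<Rightarrow> bool" where
  "finite_dim_vsubspace Y E \<longleftrightarrow>
     vsubspace Y E \<and> (\<exists>F. finite F \<and> F \<subseteq> E \<and> (\<forall>E'. vsubspace Y E' \<and> F \<subseteq> E' \<longrightarrow> E \<subseteq> E'))"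

definition finitely_representable_in ::
    "'u normed_structure \<Rightarrow> 'a::real_normed_vector itself \<Rightarrow> bool" where
  "finitely_representable_in Y _ \<longleftrightarrow>
     (\<forall>E \<epsilon>. finite_dim_vsubspace Y E \<and> \<epsilon> > 0 \<longrightarrow>
        (\<exists>T :: 'u \<Rightarrow> 'a. vlinear_on Y E T \<and>
           (\<forall>y\<in>E. (1 - \<epsilon>) * vnorm Y y \<le> norm (T y) \<and> norm (T y) \<le> (1 + \<epsilon>) * vnorm Y y)))"

text \<open>
  The test spaces have their points in the type of sets of sequences in \<open>X\<close>, which contains for
  instance \<open>X\<close> itself and its countable ultrapowers (as sets of cosets). This bound on the size of
  the test spaces loses nothing: if a non-reflexive Banach space is finitely representable in \<open>X\<close>,
  then so is, by the Eberlein-Smulian theorem, a separable non-reflexive closed subspace of it; that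
  subspace has at most continuum many points, and since \<open>X\<close> is then non-zero, it has an isometric
  copy with points in this type.
\<close>

definition super_reflexive :: "'a::real_normed_vector itself \<Rightarrow> bool" where
  "super_reflexive X \<longleftrightarrow>
     (\<forall>Y :: (nat \<Rightarrow> 'a) set normed_structure.
        banach_structure Y \<and> finitely_representable_in Y X \<longrightarrow> reflexive_structure Y)"


section \<open>Renormings\<close>

definition equivalent_norm :: "('a::real_normed_vector \<Rightarrow> real) \<Rightarrow> bool" where
  "equivalent_norm N \<longleftrightarrow>
     (\<forall>x y. N (x + y) \<le> N x + N y) \<and> (\<forall>r x. N (r *\<^sub>R x) = \<bar>r\<bar> * N x) \<and>
     (\<exists>a>0. \<exists>b>0. \<forall>x. a * norm x \<le> N x \<and> N x \<le> b * norm x)"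

definition smooth_renorming :: "'a::real_normed_vector itself \<Rightarrow> real \<Rightarrow> bool" where
  "smooth_renorming _ \<alpha> \<longleftrightarrow>
     (\<exists>N :: 'a \<Rightarrow> real. \<exists>C>0. equivalent_norm N \<and>
        (\<forall>x h. N (x + h) powr (1 + \<alpha>) + N (x - h) powr (1 + \<alpha>) - 2 * N x powr (1 + \<alpha>)
               \<le> C * N h powr (1 + \<alpha>)))"


section \<open>Function spaces\<close>

text \<open>
  A modulus is a function \<open>\<omega> :: real \<Rightarrow> real\<close> of which only the values on \<open>{0<..}\<close> are used. Suprema of
  oscillations are taken in \<^typ>\<open>ennreal\<close>: they may be infinite, and the supremum of the empty set,
  which occurs for the zero space, is 0.
\<close>

definition osc :: "(real \<Rightarrow> real) \<Rightarrow> ('a::real_normed_vector \<Rightarrow> real) \<Rightarrow> 'a \<Rightarrow> 'a \<Rightarrow> real" where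
  "osc \<omega> f x y = \<bar>f x - f y\<bar> / \<omega> (norm (x - y))"

definition osc_at :: "(real \<Rightarrow> real) \<Rightarrow> ('a::real_normed_vector \<Rightarrow> real) \<Rightarrow> real \<Rightarrow> ennreal" where
  "osc_at \<omega> f \<delta> = (SUP (x, y)\<in>{(x, y). norm (x - y) = \<delta>}. ennreal (osc \<omega> f x y))"

definition osc_far :: "(real \<Rightarrow> real) \<Rightarrow> ('a::real_normed_vector \<Rightarrow> real) \<Rightarrow> real \<Rightarrow> ennreal" where
  "osc_far \<omega> f \<delta> =
     (SUP (x, y)\<in>{(x, y). x \<noteq> y \<and> min (norm x) (norm y) > \<delta>}. ennreal (osc \<omega> f x y))"

definition C0_seminorm :: "(real \<Rightarrow> real) \<Rightarrow> ('a::real_normed_vector \<Rightarrow> real) \<Rightarrow> ennreal" where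
  "C0_seminorm \<omega> f = (SUP (x, y)\<in>{(x, y). x \<noteq> y}. ennreal (osc \<omega> f x y))"

definition C0_dot :: "(real \<Rightarrow> real) \<Rightarrow> ('a::real_normed_vector \<Rightarrow> real) set" where
  "C0_dot \<omega> = {f. C0_seminorm \<omega> f < \<infinity>}"

definition VC_small :: "(real \<Rightarrow> real) \<Rightarrow> ('a::real_normed_vector \<Rightarrow> real) set" where
  "VC_small \<omega> = {f \<in> C0_dot \<omega>. (osc_at \<omega> f \<longlongrightarrow> 0) (at_right 0)}"

definition VC_large :: "(real \<Rightarrow> real) \<Rightarrow> ('a::real_normed_vector \<Rightarrow> real) set" where
  "VC_large \<omega> = {f \<in> C0_dot \<omega>. (osc_at \<omega> f \<longlongrightarrow> 0) at_top}"

definition VC_far :: "(real \<Rightarrow> real) \<Rightarrow> ('a::real_normed_vector \<Rightarrow> real) set" where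
  "VC_far \<omega> = {f \<in> C0_dot \<omega>. (osc_far \<omega> f \<longlongrightarrow> 0) at_top}"

definition VC :: "(real \<Rightarrow> real) \<Rightarrow> ('a::real_normed_vector \<Rightarrow> real) set" where
  "VC \<omega> = VC_small \<omega> \<inter> VC_large \<omega> \<inter> VC_far \<omega>"

definition Lip :: "('a::real_normed_vector \<Rightarrow> real) set" where
  "Lip = {f. \<exists>L. L-lipschitz_on UNIV f}"

text \<open>The norm of \<^typ>\<open>'a \<Rightarrow>\<^sub>L real\<close> is the operator norm, that is, the dual norm.\<close>

definition C1 :: "real \<Rightarrow> ('a::real_normed_vector \<Rightarrow> real) set" where
  "C1 \<alpha> = {f. \<exists>D :: 'a \<Rightarrow> 'a \<Rightarrow>\<^sub>L real.
      (\<forall>x. (f has_derivative blinfun_apply (D x)) (at x)) \<and>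
      (\<exists>K. \<forall>x y. x \<noteq> y \<longrightarrow> norm (D x - D y) / norm (x - y) powr \<alpha> \<le> K)}"

definition C1_bs :: "real \<Rightarrow> ('a::real_normed_vector \<Rightarrow> real) set" where
  "C1_bs \<alpha> = {f \<in> C1 \<alpha>. \<exists>R. \<forall>x. x \<notin> ball 0 R \<longrightarrow> f x = 0}"

definition C0_closure ::
    "(real \<Rightarrow> real) \<Rightarrow> ('a::real_normed_vector \<Rightarrow> real) set \<Rightarrow> ('a \<Rightarrow> real) set" where
  "C0_closure \<omega> \<C> = {f \<in> C0_dot \<omega>. \<exists>F :: nat \<Rightarrow> 'a \<Rightarrow> real.
      (\<forall>n. F n \<in> \<C>) \<and> (\<lambda>n. C0_seminorm \<omega> (\<lambda>x. F n x - f x)) \<longlonglongrightarrow> 0}"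

end

theory Submission
  imports Defs
begin

text \<open>
  Fix \<open>p = 1 + \<alpha>\<close> and let \<open>U f\<close> be the largest function below \<open>f\<close> whose second differences are at
  least \<open>- B \<parallel>h\<parallel>\<^sup>p\<close>. The class of such minorants is invariant under translations, averages and suprema,
  so \<open>U\<close> preserves every upper bound on second differences and every bound on
  \<open>f (x + h) - f x\<close>, while the smooth renorming \<open>N\<close> supplies the minorants \<open>c - K N(x - z)\<^sup>p\<close>, which show
  that \<open>U f\<close> is uniformly close to a uniformly continuous \<open>f\<close> when \<open>B\<close> is large. Applying \<open>U\<close> to \<open>- f\<close>
  and then to the negative of the result gives a function whose second differences are bounded by
  \<open>B \<parallel>h\<parallel>\<^sup>p\<close> on both sides; such a function is in \<open>C\<^sup>1\<^sup>,\<^sup>\<alpha>\<close>. Uniform closeness controls the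
  oscillation of the error at large distances, and the preserved modulus of continuity controls it
  at small distances. For the second identity, \<open>f\<close> is first multiplied by a cutoff at scale \<open>R\<close>: the
  condition at infinity forces \<open>f x = o(\<parallel>x\<parallel>)\<close>, so that the error is small for large \<open>R\<close>.
\<close>

section \<open>Semiconvex envelopes\<close>

definition semiconvex :: "('a::real_vector \<Rightarrow> real) \<Rightarrow> ('a \<Rightarrow> real) \<Rightarrow> bool" where
  "semiconvex q f \<longleftrightarrow> (\<forall>x h. - q h \<le> f (x + h) + f (x - h) - 2 * f x)"

text \<open>A real supremum over an empty family carries no information, so the lemmas below take a
  minorant \<open>\<phi>\<^sub>0\<close> as witness; \<open>f x\<close> itself bounds the family
  from above.\<close>

definition semiconvex_envelope :: "('a::real_vector \<Rightarrow> real) \<Rightarrow> ('a \<Rightarrow> real) \<Rightarrow> 'a \<Rightarrow> real" where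
  "semiconvex_envelope q f x = (SUP \<phi>\<in>{\<phi>. semiconvex q \<phi> \<and> \<phi> \<le> f}. \<phi> x)"

lemma le_semiconvex_envelope:
  assumes "semiconvex q \<phi>" "\<phi> \<le> f"
  shows "\<phi> x \<le> semiconvex_envelope q f x"
  unfolding semiconvex_envelope_def
proof (rule cSUP_upper)
  show "bdd_above ((\<lambda>\<phi>. \<phi> x) ` {\<phi>. semiconvex q \<phi> \<and> \<phi> \<le> f})"
    by (rule bdd_aboveI[of _ "f x"]) (auto simp: le_fun_def)
qed (use assms in auto)

lemma semiconvex_envelope_least:
  assumes "semiconvex q \<phi>\<^sub>0" "\<phi>\<^sub>0 \<le> f"
    and "\<And>\<phi>. semiconvex q \<phi> \<Longrightarrow> \<phi> \<le> f \<Longrightarrow> \<phi> x \<le> c"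
  shows "semiconvex_envelope q f x \<le> c"
  unfolding semiconvex_envelope_def by (rule cSUP_least) (use assms in auto)

lemma semiconvex_envelope_le:
  assumes "semiconvex q \<phi>\<^sub>0" "\<phi>\<^sub>0 \<le> f"
  shows "semiconvex_envelope q f \<le> f"
  by (rule le_funI, rule semiconvex_envelope_least[OF assms]) (auto simp: le_fun_def)

text \<open>Only the value at \<open>x\<close> enters with a negative sign, so for each minorant the
  values at \<open>x + h\<close> and \<open>x - h\<close> may be raised to the envelope before the
  supremum is taken at \<open>x\<close>.\<close>

lemma semiconvex_semiconvex_envelope:
  assumes "semiconvex q \<phi>\<^sub>0" "\<phi>\<^sub>0 \<le> f"
  shows "semiconvex q (semiconvex_envelope q f)"
  unfolding semiconvex_def
proof (intro allI)
  fix x h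
  let ?U = "semiconvex_envelope q f"
  have "?U x \<le> (?U (x + h) + ?U (x - h) + q h) / 2"
  proof (rule semiconvex_envelope_least[OF assms])
    fix \<phi> assume \<phi>: "semiconvex q \<phi>" "\<phi> \<le> f"
    have "- q h \<le> \<phi> (x + h) + \<phi> (x - h) - 2 * \<phi> x"
      using \<phi>(1) by (auto simp: semiconvex_def)
    with le_semiconvex_envelope[OF \<phi>, of "x + h"] le_semiconvex_envelope[OF \<phi>, of "x - h"]
    show "\<phi> x \<le> (?U (x + h) + ?U (x - h) + q h) / 2" by simp
  qed
  then show "- q h \<le> ?U (x + h) + ?U (x - h) - 2 * ?U x" by simp
qed

lemma semiconvex_translate:
  assumes "semiconvex q \<phi>"
  shows "semiconvex q (\<lambda>x. \<phi> (x + v) - b)"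
  unfolding semiconvex_def
proof (intro allI)
  fix x h
  show "- q h \<le> \<phi> (x + h + v) - b + (\<phi> (x - h + v) - b) - 2 * (\<phi> (x + v) - b)"
    using assms[unfolded semiconvex_def, rule_format, of h "x + v"] by (simp add: algebra_simps)
qed

lemma semiconvex_average:
  assumes "semiconvex q \<phi>" "semiconvex q \<psi>"
  shows "semiconvex q (\<lambda>x. (\<phi> x + \<psi> x) / 2)"
  unfolding semiconvex_def
proof (intro allI)
  fix x h
  show "- q h \<le> (\<phi> (x + h) + \<psi> (x + h)) / 2 + (\<phi> (x - h) + \<psi> (x - h)) / 2
      - 2 * ((\<phi> x + \<psi> x) / 2)"
    using assms[unfolded semiconvex_def, rule_format, of h x] by argo
qed

text \<open>A minorant shifted by \<open>h\<close> and lowered by \<open>b\<close> is again a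
  minorant of \<open>f\<close>, hence competes in the supremum at \<open>x\<close>.\<close>

lemma semiconvex_envelope_translate:
  assumes "semiconvex q \<phi>\<^sub>0" "\<phi>\<^sub>0 \<le> f" and "\<And>y. f (y + h) \<le> f y + b"
  shows "semiconvex_envelope q f (x + h) \<le> semiconvex_envelope q f x + b"
proof (rule semiconvex_envelope_least[OF assms(1,2)])
  fix \<phi> assume \<phi>: "semiconvex q \<phi>" "\<phi> \<le> f"
  have "(\<lambda>x. \<phi> (x + h) - b) \<le> f"
  proof (rule le_funI)
    fix y
    show "\<phi> (y + h) - b \<le> f y"
      using le_funD[OF \<phi>(2), of "y + h"] assms(3)[of y] by simp
  qed
  from le_semiconvex_envelope[OF semiconvex_translate[OF \<phi>(1)] this, of x]
  show "\<phi> (x + h) \<le> semiconvex_envelope q f x + b" by simp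
qed

text \<open>The minorants are stable under averages of translates: this is why the envelope inherits
  upper bounds on second differences.\<close>

lemma semiconvex_envelope_semiconcave:
  assumes "semiconvex q \<phi>\<^sub>0" "\<phi>\<^sub>0 \<le> f" and "semiconvex r (\<lambda>x. - f x)"
  shows "semiconvex r (\<lambda>x. - semiconvex_envelope q f x)"
  unfolding semiconvex_def
proof (intro allI)
  fix x h
  let ?U = "semiconvex_envelope q f"
  \<comment> \<open>Lowering each translate by \<open>r h / 2\<close> lowers the average by exactly
    what the upper bound on the second differences of \<open>f\<close> permits, so the result stays
    below \<open>f\<close>.\<close>
  let ?\<phi> = "\<lambda>x. (?U (x + h) - r h / 2 + (?U (x + - h) - r h / 2)) / 2"
  note U = semiconvex_semiconvex_envelope[OF assms(1,2)]
  note le = semiconvex_envelope_le[OF assms(1,2)]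
  have "?\<phi> \<le> f"
  proof (rule le_funI)
    fix y
    show "?\<phi> y \<le> f y"
      using assms(3)[unfolded semiconvex_def, rule_format, of h y]
        le_funD[OF le, of "y + h"] le_funD[OF le, of "y + - h"] by simp
  qed
  from le_semiconvex_envelope[OF semiconvex_average[OF semiconvex_translate[OF U] semiconvex_translate[OF U]] this, of x]
  show "- r h \<le> - ?U (x + h) + - ?U (x - h) - 2 * - ?U x" by simp
qed

text \<open>The increment clause treats each shift \<open>h\<close> separately, so every modulus of
  continuity of \<open>f\<close> passes to \<open>g\<close>. All three clauses compose, with errors
  adding up, which allows two envelopes in succession.\<close>

definition regularizes :: "real \<Rightarrow> ('a::real_normed_vector \<Rightarrow> real) \<Rightarrow> ('a \<Rightarrow> real) \<Rightarrow> bool" where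
  "regularizes \<eta> f g \<longleftrightarrow>
     (\<forall>x. \<bar>g x - f x\<bar> \<le> \<eta>) \<and>
     (\<forall>h b. (\<forall>x. \<bar>f (x + h) - f x\<bar> \<le> b) \<longrightarrow> (\<forall>x. \<bar>g (x + h) - g x\<bar> \<le> b)) \<and>
     (\<forall>R. (\<forall>x. x \<notin> ball 0 R \<longrightarrow> f x = 0) \<longrightarrow> (\<exists>R'. \<forall>x. x \<notin> ball 0 R' \<longrightarrow> g x = 0))"

lemma regularizes_trans:
  assumes "regularizes \<eta> f g" "regularizes \<theta> g k"
  shows "regularizes (\<eta> + \<theta>) f k"
  unfolding regularizes_def
proof (intro conjI allI impI)
  fix x
  have "\<bar>g x - f x\<bar> \<le> \<eta>" "\<bar>k x - g x\<bar> \<le> \<theta>" using assms unfolding regularizes_def by blast+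
  then show "\<bar>k x - f x\<bar> \<le> \<eta> + \<theta>" by linarith
next
  fix h b x assume "\<forall>x. \<bar>f (x + h) - f x\<bar> \<le> b"
  then show "\<bar>k (x + h) - k x\<bar> \<le> b" using assms unfolding regularizes_def by blast
next
  fix R assume "\<forall>x. x \<notin> ball 0 R \<longrightarrow> f x = 0"
  then show "\<exists>R'. \<forall>x. x \<notin> ball 0 R' \<longrightarrow> k x = 0"
    using assms unfolding regularizes_def by blast
qed

lemma regularizes_uminus_iff: "regularizes \<eta> (\<lambda>x. - f x) (\<lambda>x. - g x) \<longleftrightarrow> regularizes \<eta> f g"
proof -
  have "\<bar>- s - - t\<bar> = \<bar>s - t\<bar>" for s t :: real by arith
  then show ?thesis unfolding regularizes_def by (simp only: neg_equal_0_iff_equal)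
qed

text \<open>The model gauge is \<open>P x = N x powr (1 + \<alpha>)\<close> for the given renorming \<open>N\<close>. The functions
  \<open>c - K P (x - z)\<close> are the semiconvex minorants that keep the envelope close to \<open>f\<close>.\<close>

locale smooth_gauge =
  fixes P :: "'a::real_normed_vector \<Rightarrow> real" and p a C :: real
  assumes p_gt_1: "1 < p" and a_pos: "0 < a" and C_pos: "0 < C"
    and P_zero: "P 0 = 0"
    and P_ge: "a * norm x powr p \<le> P x"
    and P_diff: "P (x + h) + P (x - h) - 2 * P x \<le> C * norm h powr p"
begin

lemma P_nonneg: "0 \<le> P x"
  using P_ge[of x] a_pos by (meson order_trans mult_nonneg_nonneg less_imp_le powr_ge_zero)

text \<open>The factor \<open>- K\<close> turns the upper bound \<open>P_diff\<close> into a lower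
  one; the translation by \<open>z\<close> and the constant \<open>c\<close> do not affect second
  differences.\<close>

lemma semiconvex_gauge:
  assumes "0 \<le> K"
  shows "semiconvex (\<lambda>h. K * C * norm h powr p) (\<lambda>x. c - K * P (x - z))"
  unfolding semiconvex_def
proof (intro allI)
  fix x h
  have "K * (P (x - z + h) + P (x - z - h) - 2 * P (x - z)) \<le> K * (C * norm h powr p)"
    using P_diff assms by (intro mult_left_mono)
  then show "- (K * C * norm h powr p) \<le> c - K * P (x + h - z) + (c - K * P (x - h - z)) - 2 * (c - K * P (x - z))"
    by (simp add: algebra_simps)
qed

text \<open>The minorant is evaluated at its vertex \<open>z\<close>, where
  \<open>P 0 = 0\<close>.\<close>

lemma le_envelope_of_gauge_minorant:
  assumes "0 \<le> K" "\<And>x. c - K * P (x - z) \<le> f x"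
  shows "c \<le> semiconvex_envelope (\<lambda>h. K * C * norm h powr p) f z"
  using le_semiconvex_envelope[OF semiconvex_gauge[OF assms(1)], of c z f z] assms(2)
  by (simp add: le_fun_def P_zero)

text \<open>The estimate is uniform in \<open>x\<close>: a single \<open>K\<close> then provides
  gauge minorants at all centres, each missing the graph of \<open>f\<close> by at most
  \<open>\<eta>\<close> at its vertex.\<close>

definition coarse :: "('a \<Rightarrow> real) \<Rightarrow> bool" where
  "coarse f \<longleftrightarrow> (\<forall>\<eta>>0. \<exists>K. \<forall>x h. \<bar>f (x + h) - f x\<bar> \<le> \<eta> + K * norm h powr p)"

lemma coarse_obtain:
  assumes "coarse f" "0 < \<eta>"
  obtains K where "0 < K" "\<And>x z. f z - \<eta> - K * P (x - z) \<le> f x"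
proof -
  obtain K where K: "\<And>x h. \<bar>f (x + h) - f x\<bar> \<le> \<eta> + K * norm h powr p"
    using assms unfolding coarse_def by blast
  show ?thesis
  proof
    \<comment> \<open>\<open>max K 1\<close> secures positivity, and dividing by \<open>a\<close>
      trades the power of the norm for \<open>P\<close> through \<open>P_ge\<close>.\<close>
    let ?K = "max K 1 / a"
    show "0 < ?K" using a_pos by simp
    fix x z
    have "\<bar>f (z + (x - z)) - f z\<bar> \<le> \<eta> + K * norm (x - z) powr p" by (rule K)
    moreover have "K * norm (x - z) powr p \<le> max K 1 * norm (x - z) powr p"
      by (intro mult_right_mono) auto
    moreover have "max K 1 * norm (x - z) powr p = ?K * (a * norm (x - z) powr p)"
      using a_pos by simp
    moreover have "\<dots> \<le> ?K * P (x - z)"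
      using a_pos P_ge by (intro mult_left_mono) auto
    ultimately show "f z - \<eta> - ?K * P (x - z) \<le> f x" by simp
  qed
qed

lemma regularizes_coarse: "regularizes \<eta> f g \<Longrightarrow> coarse f \<Longrightarrow> coarse g"
  unfolding regularizes_def coarse_def by meson

lemma coarse_uminus: "coarse f \<Longrightarrow> coarse (\<lambda>x. - f x)"
proof -
  have "\<bar>- s - - t\<bar> = \<bar>s - t\<bar>" for s t :: real by arith
  then show "coarse f \<Longrightarrow> coarse (\<lambda>x. - f x)" unfolding coarse_def by (simp only:)
qed

lemma coarse_bounded_support:
  assumes "coarse f" "\<And>x. x \<notin> ball 0 R \<Longrightarrow> f x = 0"
  shows "\<exists>M. \<forall>x. \<bar>f x\<bar> \<le> M"
proof -
  obtain K where K: "\<And>x h. \<bar>f (x + h) - f x\<bar> \<le> 1 + K * norm h powr p"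
    using assms(1) zero_less_one unfolding coarse_def by blast
  have "\<bar>f x\<bar> \<le> \<bar>f 0\<bar> + 1 + \<bar>K\<bar> * R powr p" for x
  proof (cases "x \<in> ball 0 R")
    case True
    have "\<bar>f (0 + x) - f 0\<bar> \<le> 1 + K * norm x powr p" by (rule K)
    also have "K * norm x powr p \<le> \<bar>K\<bar> * R powr p"
      using True p_gt_1 by (intro mult_mono powr_mono2) auto
    finally show ?thesis by simp
  next
    case False
    then show ?thesis using assms(2) by simp
  qed
  then show ?thesis by blast
qed

text \<open>For \<open>z\<close> far from the support, the minorant with vertex height
  \<open>0\<close> at \<open>z\<close> lies below \<open>f\<close>: over the support it has dropped
  below \<open>- M\<close>, and elsewhere \<open>f\<close> vanishes. So the envelope at
  \<open>z\<close> lies between \<open>0\<close> and \<open>f z = 0\<close>.\<close>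

lemma envelope_bounded_support:
  fixes f :: "'a \<Rightarrow> real"
  assumes "0 < K" "\<And>x. - M \<le> f x" "\<And>x. x \<notin> ball 0 R \<Longrightarrow> f x = 0"
  shows "\<exists>R'. \<forall>x. x \<notin> ball 0 R' \<longrightarrow> semiconvex_envelope (\<lambda>h. K * C * norm h powr p) f x = 0"
proof (intro exI allI impI)
  \<comment> \<open>At distance \<open>s\<close> the minorant has dropped by at least
    \<open>K * a * s powr p\<close>, which is at least \<open>M\<close>; the \<open>max 0\<close>
    covers negative \<open>M\<close>.\<close>
  define s where "s = max 0 (M / (K * a)) powr (1 / p)"
  let ?U = "semiconvex_envelope (\<lambda>h. K * C * norm h powr p) f"
  fix z :: 'a assume z: "z \<notin> ball 0 (\<bar>R\<bar> + s)"
  have s0: "0 \<le> s" by (simp add: s_def)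
  have sp: "s powr p = max 0 (M / (K * a))"
    using p_gt_1 by (simp add: s_def powr_powr)
  have min: "0 - K * P (x - z) \<le> f x" for x
  proof (cases "x \<in> ball 0 R")
    case True
    have "s \<le> norm (x - z)"
      using True z norm_triangle_ineq2[of z x] by (simp add: norm_minus_commute)
    then have "M / (K * a) \<le> norm (x - z) powr p"
      using powr_mono2[of p s "norm (x - z)"] s0 p_gt_1 sp by simp
    then have "M \<le> K * (a * norm (x - z) powr p)"
      using assms(1) a_pos by (simp add: field_simps)
    also have "\<dots> \<le> K * P (x - z)" using assms(1) P_ge by (intro mult_left_mono) auto
    finally show ?thesis using assms(2)[of x] by simp
  next
    case False
    then show ?thesis using assms(1,3) P_nonneg by simp
  qed
  have "0 \<le> ?U z"
    by (rule le_envelope_of_gauge_minorant) (use assms(1) min in auto)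
  moreover have "?U z \<le> f z"
    by (rule le_funD[OF semiconvex_envelope_le[OF semiconvex_gauge[of K 0 z]]])
      (use assms(1) min in \<open>auto simp: le_fun_def\<close>)
  moreover have "f z = 0" using assms(3) z s0 by simp
  ultimately show "?U z = 0" by simp
qed

text \<open>The envelope with \<open>K\<close> taken from coarseness at error \<open>\<eta>\<close>
  does it. The last clause, for arbitrary \<open>r\<close>, lets a second envelope keep the bound
  produced by a first one.\<close>

lemma one_sided_regularization:
  assumes f: "coarse f" and \<eta>: "0 < \<eta>"
  shows "\<exists>g B. regularizes \<eta> f g \<and> semiconvex (\<lambda>h. B * norm h powr p) g \<and>
    (\<forall>r. semiconvex r (\<lambda>x. - f x) \<longrightarrow> semiconvex r (\<lambda>x. - g x))"
proof -
  obtain K where K: "0 < K" "\<And>x z. f z - \<eta> - K * P (x - z) \<le> f x"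
    using coarse_obtain[OF f \<eta>] by blast
  define g where "g = semiconvex_envelope (\<lambda>h. K * C * norm h powr p) f"
  have sc: "semiconvex (\<lambda>h. K * C * norm h powr p) (\<lambda>x. f 0 - \<eta> - K * P (x - 0))"
    using K(1) by (intro semiconvex_gauge) simp
  have le: "(\<lambda>x. f 0 - \<eta> - K * P (x - 0)) \<le> f"
    by (rule le_funI) (rule K(2))
  have "regularizes \<eta> f g"
    unfolding regularizes_def
  proof (intro conjI allI impI)
    fix x
    have "f x - \<eta> \<le> g x"
      unfolding g_def by (rule le_envelope_of_gauge_minorant[OF less_imp_le[OF K(1)] K(2)])
    moreover have "g x \<le> f x"
      unfolding g_def by (rule le_funD[OF semiconvex_envelope_le[OF sc le]])
    ultimately show "\<bar>g x - f x\<bar> \<le> \<eta>" using \<eta> by simp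
  next
    fix h b y assume b: "\<forall>y. \<bar>f (y + h) - f y\<bar> \<le> b"
    have "g (y + h) \<le> g y + b"
      unfolding g_def
    proof (rule semiconvex_envelope_translate[OF sc le])
      show "f (y + h) \<le> f y + b" for y using b[rule_format, of y] by simp
    qed
    \<comment> \<open>The translation bound is one-sided; shifting back by \<open>- h\<close> gives
      the other half of the absolute value.\<close>
    moreover have "g (y + h + - h) \<le> g (y + h) + b"
      unfolding g_def
    proof (rule semiconvex_envelope_translate[OF sc le])
      show "f (y + - h) \<le> f y + b" for y using b[rule_format, of "y - h"] by simp
    qed
    ultimately show "\<bar>g (y + h) - g y\<bar> \<le> b" by simp
  next
    fix R assume R: "\<forall>x. x \<notin> ball 0 R \<longrightarrow> f x = 0"
    obtain M where M: "\<forall>x. \<bar>f x\<bar> \<le> M"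
      using coarse_bounded_support[OF f] R by blast
    have M': "- M \<le> f x" for x using M[rule_format, of x] by simp
    show "\<exists>R'. \<forall>x. x \<notin> ball 0 R' \<longrightarrow> g x = 0"
      unfolding g_def by (rule envelope_bounded_support[OF K(1) M']) (use R in blast)
  qed
  moreover have "semiconvex (\<lambda>h. K * C * norm h powr p) g"
    unfolding g_def by (rule semiconvex_semiconvex_envelope[OF sc le])
  moreover have "\<forall>r. semiconvex r (\<lambda>x. - f x) \<longrightarrow> semiconvex r (\<lambda>x. - g x)"
    unfolding g_def using semiconvex_envelope_semiconcave[OF sc le] by blast
  ultimately show ?thesis by blast
qed

text \<open>Two envelopes, each with error \<open>\<eta> / 2\<close>: the one of \<open>- f\<close>
  yields, after a change of sign, the upper bound with constant \<open>A\<close>, and the second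
  adds the lower bound with constant \<open>B\<close>.\<close>

lemma two_sided_regularization:
  assumes f: "coarse f" and \<eta>: "0 < \<eta>"
  shows "\<exists>g B. regularizes \<eta> f g \<and>
    (\<forall>x h. \<bar>g (x + h) + g (x - h) - 2 * g x\<bar> \<le> B * norm h powr p)"
proof -
  have \<eta>2: "0 < \<eta> / 2" using \<eta> by simp
  obtain u A where u: "regularizes (\<eta> / 2) (\<lambda>x. - f x) u" "semiconvex (\<lambda>h. A * norm h powr p) u"
    using one_sided_regularization[OF coarse_uminus[OF f] \<eta>2] by blast
  have "coarse u" by (rule regularizes_coarse[OF u(1) coarse_uminus[OF f]])
  from one_sided_regularization[OF coarse_uminus[OF this] \<eta>2]
  obtain g B where g: "regularizes (\<eta> / 2) (\<lambda>x. - u x) g" "semiconvex (\<lambda>h. B * norm h powr p) g"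
    "\<forall>r. semiconvex r (\<lambda>x. - (- u x)) \<longrightarrow> semiconvex r (\<lambda>x. - g x)"
    by blast
  \<comment> \<open>Semiconvexity of \<open>u\<close> is an upper bound on the second differences of
    \<open>- u\<close>, and the second envelope preserves it.\<close>
  have g': "semiconvex (\<lambda>h. A * norm h powr p) (\<lambda>x. - g x)"
    using g(3) u(2) by simp
  have "regularizes (\<eta> / 2) f (\<lambda>x. - u x)"
    using u(1) regularizes_uminus_iff[of "\<eta> / 2" f "\<lambda>x. - u x"] by simp
  from regularizes_trans[OF this g(1)] have "regularizes \<eta> f g" by simp
  moreover have "\<bar>g (x + h) + g (x - h) - 2 * g x\<bar> \<le> max A B * norm h powr p" for x h
  proof -
    have "A * norm h powr p \<le> max A B * norm h powr p" "B * norm h powr p \<le> max A B * norm h powr p"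
      by (auto intro: mult_right_mono)
    moreover have "- (B * norm h powr p) \<le> g (x + h) + g (x - h) - 2 * g x"
      "- (A * norm h powr p) \<le> - g (x + h) + - g (x - h) - 2 * - g x"
      using g(2) g' unfolding semiconvex_def by blast+
    ultimately show ?thesis by linarith
  qed
  ultimately show ?thesis by blast
qed

end

section \<open>Second differences and Hoelder derivatives\<close>

text \<open>This is Cauchy's functional equation. Additivity gives homogeneity over the integers,
  and a defect \<open>e\<close> at a real factor would be multiplied by every \<open>n\<close>,
  against boundedness on the unit ball.\<close>

lemma additive_bounded_imp_bounded_linear:
  fixes D :: "'a::real_normed_vector \<Rightarrow> real"
  assumes add: "\<And>x y. D (x + y) = D x + D y"
    and bound: "\<And>x. norm x \<le> 1 \<Longrightarrow> \<bar>D x\<bar> \<le> B"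
  shows "bounded_linear D" and "\<bar>D x\<bar> \<le> B * norm x"
proof -
  have D0: "D 0 = 0" using add[of 0 0] by simp
  have Dneg: "D (- x) = - D x" for x using add[of x "- x"] D0 by simp
  have Dnat: "D (real n *\<^sub>R x) = real n * D x" for n x
    by (induction n) (simp_all add: D0 add scaleR_add_left distrib_right)
  have B0: "0 \<le> B" using bound[of 0] D0 by simp
  have small: "\<bar>D x\<bar> * real n \<le> B" if "norm x * real n \<le> 1" for x n
    using bound[of "real n *\<^sub>R x"] Dnat[of n x] that by (simp add: abs_mult mult.commute)
  have scale: "D (r *\<^sub>R x) = r * D x" for r x
  proof (rule ccontr)
    assume "D (r *\<^sub>R x) \<noteq> r * D x"
    define e where "e = \<bar>D (r *\<^sub>R x) - r * D x\<bar>"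
    have e: "0 < e" using \<open>D (r *\<^sub>R x) \<noteq> r * D x\<close> by (simp add: e_def)
    obtain n where "(B + norm x * B + \<bar>D x\<bar> + 1) / e < real n"
      using reals_Archimedean2 by blast
    then have n: "B + norm x * B + \<bar>D x\<bar> + 1 < real n * e" using e by (simp add: field_simps)
    \<comment> \<open>Splitting \<open>n * r\<close> into its integer part \<open>k\<close> and a
      fraction \<open>t\<close> leaves a defect that involves only \<open>t *\<^sub>R x\<close>, so
      it is bounded independently of \<open>n\<close>.\<close>
    define k where "k = \<lfloor>real n * r\<rfloor>"
    define t where "t = real n * r - of_int k"
    have t: "0 \<le> t" "t \<le> 1" unfolding t_def k_def by linarith+
    have Dint: "D (of_int k *\<^sub>R x) = of_int k * D x"
      by (cases k rule: int_cases2) (simp_all add: Dnat Dneg)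
    have "(real n * r) *\<^sub>R x = of_int k *\<^sub>R x + t *\<^sub>R x"
      by (simp add: t_def scaleR_diff_left)
    then have "D ((real n * r) *\<^sub>R x) = of_int k * D x + D (t *\<^sub>R x)" using add Dint by simp
    then have "real n * (D (r *\<^sub>R x) - r * D x) = D (t *\<^sub>R x) - t * D x"
      using Dnat[of n "r *\<^sub>R x"] by (simp add: t_def algebra_simps)
    then have "real n * e = \<bar>D (t *\<^sub>R x) - t * D x\<bar>"
      unfolding e_def by (metis abs_mult abs_of_nat)
    also have "\<dots> \<le> \<bar>D (t *\<^sub>R x)\<bar> + \<bar>D x\<bar>"
    proof -
      have "\<bar>t * D x\<bar> \<le> 1 * \<bar>D x\<bar>" using t unfolding abs_mult by (intro mult_right_mono) auto
      then show ?thesis by simp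
    qed
    also have "\<bar>D (t *\<^sub>R x)\<bar> \<le> B * (norm x + 1)"
    proof -
      \<comment> \<open>A positive integer \<open>m\<close> that brings \<open>t *\<^sub>R x\<close>
        into the unit ball; an integer is needed because homogeneity is so far known only for
        integers.\<close>
      obtain m where m: "norm (t *\<^sub>R x) \<le> real m" "real m \<le> norm (t *\<^sub>R x) + 1" "0 < m"
      proof -
        have "0 \<le> norm (t *\<^sub>R x)" by simp
        then show ?thesis
          by (intro that[of "nat \<lfloor>norm (t *\<^sub>R x) + 1\<rfloor>"]) (linarith+)
      qed
      define y where "y = (1 / real m) *\<^sub>R (t *\<^sub>R x)"
      have y: "t *\<^sub>R x = real m *\<^sub>R y" using m(3) by (simp add: y_def)
      have "norm y \<le> 1"
        using m(1,3) by (simp add: y_def field_simps)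
      from bound[OF this] have "\<bar>D (t *\<^sub>R x)\<bar> \<le> real m * B"
        unfolding y Dnat by (simp add: abs_mult mult_left_mono)
      also have "real m * B \<le> (norm x + 1) * B"
      proof (rule mult_right_mono[OF _ B0])
        have "norm (t *\<^sub>R x) \<le> 1 * norm x"
          using t unfolding norm_scaleR by (intro mult_right_mono) auto
        then show "real m \<le> norm x + 1" using m(2) by simp
      qed
      finally show ?thesis by (simp add: mult.commute)
    qed
    finally have "real n * e \<le> B * (norm x + 1) + \<bar>D x\<bar>" by simp
    then show False using n by (simp add: algebra_simps)
  qed
  show le: "\<bar>D x\<bar> \<le> B * norm x" for x
  proof (cases "x = 0")
    case False
    have "\<bar>D ((1 / norm x) *\<^sub>R x)\<bar> \<le> B" using False by (intro bound) simp
    then show ?thesis using False unfolding scale by (simp add: abs_mult field_simps)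
  qed (simp add: D0)
  show "bounded_linear D"
    by (rule bounded_linear_intro[of D B]) (use add scale le in \<open>auto simp: mult.commute\<close>)
qed

text \<open>The factor \<open>(1 / 2) ^ n\<close> cancels the \<open>2 ^ n\<close> of a dyadic
  difference quotient, and a convergent geometric factor remains.\<close>

lemma dyadic_powr:
  fixes s \<alpha> :: real
  assumes "0 \<le> s"
  shows "(s / 2 ^ n) powr (1 + \<alpha>) = s powr (1 + \<alpha>) * ((1 / 2) ^ n * ((1 / 2) powr \<alpha>) ^ n)"
proof -
  have "(s / 2 ^ n) powr (1 + \<alpha>) = s powr (1 + \<alpha>) * ((1 / 2) ^ n) powr (1 + \<alpha>)"
    using assms by (simp flip: powr_mult add: power_divide)
  also have "((1 / 2 :: real) ^ n) powr (1 + \<alpha>) = (1 / 2) ^ n * ((1 / 2) ^ n) powr \<alpha>"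
    by (simp add: powr_add)
  also have "((1 / 2 :: real) ^ n) powr \<alpha> = ((1 / 2) powr \<alpha>) ^ n"
    by (simp add: powr_realpow[symmetric] powr_powr mult.commute)
  finally show ?thesis .
qed

text \<open>Second differences alone cannot give regularity, since they vanish for discontinuous
  additive functions; the bound \<open>M\<close> on unit increments excludes these.\<close>

locale small_second_differences =
  fixes g :: "'a::real_normed_vector \<Rightarrow> real" and \<alpha> B M :: real
  assumes \<alpha>: "0 < \<alpha>"
    and second_diff: "\<bar>g (x + h) + g (x - h) - 2 * g x\<bar> \<le> B * norm h powr (1 + \<alpha>)"
    and unit_diff: "norm h \<le> 1 \<Longrightarrow> \<bar>g (x + h) - g x\<bar> \<le> M"
begin

lemma midpoint_bound:
  assumes "norm (x - y) \<le> 2 * s"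
  shows "\<bar>g x + g y - 2 * g ((1 / 2) *\<^sub>R (x + y))\<bar> \<le> \<bar>B\<bar> * s powr (1 + \<alpha>)"
proof -
  let ?h = "(1 / 2) *\<^sub>R (x - y)" and ?z = "(1 / 2) *\<^sub>R (x + y)"
  have "?z + ?h = (1 / 2) *\<^sub>R (2 *\<^sub>R x)" "?z - ?h = (1 / 2) *\<^sub>R (2 *\<^sub>R y)"
    unfolding scaleR_add_right[symmetric] scaleR_diff_right[symmetric] by (simp_all add: scaleR_2)
  then have eq: "?z + ?h = x" "?z - ?h = y" by simp_all
  have "\<bar>g x + g y - 2 * g ?z\<bar> \<le> B * norm ?h powr (1 + \<alpha>)"
    using second_diff[of ?z ?h] unfolding eq .
  also have "\<dots> \<le> \<bar>B\<bar> * s powr (1 + \<alpha>)"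
    using assms \<alpha> by (intro mult_mono powr_mono2) auto
  finally show ?thesis .
qed

text \<open>The two diagonals of the parallelogram have the same midpoint, so its value drops out
  when the two midpoint estimates are subtracted.\<close>

lemma parallelogram_bound:
  assumes "norm u + norm v \<le> 2 * s"
  shows "\<bar>g (x + u) + g (x + v) - g (x + u + v) - g x\<bar> \<le> 2 * \<bar>B\<bar> * s powr (1 + \<alpha>)"
proof -
  have "norm (x + u - (x + v)) \<le> 2 * s" "norm (x + u + v - x) \<le> 2 * s"
    using assms norm_triangle_ineq4[of u v] norm_triangle_ineq[of u v] by (simp_all add: algebra_simps)
  from this[THEN midpoint_bound]
  have "\<bar>g (x + u) + g (x + v) - 2 * g ((1 / 2) *\<^sub>R (x + u + (x + v)))\<bar> \<le> \<bar>B\<bar> * s powr (1 + \<alpha>)"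
    "\<bar>g (x + u + v) + g x - 2 * g ((1 / 2) *\<^sub>R (x + u + v + x))\<bar> \<le> \<bar>B\<bar> * s powr (1 + \<alpha>)" .
  moreover have eq: "x + u + (x + v) = x + u + v + x" by (simp add: algebra_simps)
  ultimately show ?thesis unfolding eq by linarith
qed

definition quotient :: "'a \<Rightarrow> 'a \<Rightarrow> nat \<Rightarrow> real" where
  "quotient x h n = 2 ^ n * (g (x + (1 / 2 ^ n) *\<^sub>R h) - g x)"

definition derivative :: "'a \<Rightarrow> 'a \<Rightarrow> real" where
  "derivative x h = lim (quotient x h)"

text \<open>The sum of the geometric series of the steps between consecutive dyadic quotients, for
  \<open>norm h = 1\<close>.\<close>

definition "remainder_const = \<bar>B\<bar> / (1 - (1 / 2) powr \<alpha>)"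

lemma quotient_step:
  "\<bar>quotient x h (Suc n) - quotient x h n\<bar> \<le> \<bar>B\<bar> * norm h powr (1 + \<alpha>) * ((1 / 2) powr \<alpha>) ^ n"
proof -
  \<comment> \<open>With this half step, the difference of consecutive quotients is a multiple of
    the second difference centred at \<open>x + k\<close> with increment \<open>k\<close>.\<close>
  define k where "k = (1 / 2 ^ Suc n) *\<^sub>R h"
  have k2: "(1 / 2 ^ n) *\<^sub>R h = k + k" by (simp add: k_def flip: scaleR_add_left)
  have "quotient x h (Suc n) - quotient x h n = - (2 ^ n * (g (x + k + k) + g (x + k - k) - 2 * g (x + k)))"
    unfolding quotient_def k2 k_def[symmetric] by (simp add: algebra_simps)
  then have "\<bar>quotient x h (Suc n) - quotient x h n\<bar>
      = 2 ^ n * \<bar>g (x + k + k) + g (x + k - k) - 2 * g (x + k)\<bar>" by (simp add: abs_mult)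
  also have "\<dots> \<le> 2 ^ n * (B * norm k powr (1 + \<alpha>))" by (intro mult_left_mono second_diff) simp
  \<comment> \<open>A factor \<open>1 / 2\<close> in \<open>norm k\<close> is given away so that the
    exponent \<open>n\<close> matches the quotient's index.\<close>
  also have "\<dots> \<le> 2 ^ n * (\<bar>B\<bar> * (norm h / 2 ^ n) powr (1 + \<alpha>))"
  proof (intro mult_left_mono mult_mono powr_mono2)
    have "norm k = norm h / 2 ^ n / 2" by (simp add: k_def)
    also have "\<dots> \<le> norm h / 2 ^ n"
    proof -
      have "z / 2 \<le> z" if "0 \<le> z" for z :: real using that by simp
      from this[of "norm h / 2 ^ n"] show ?thesis by simp
    qed
    finally show "norm k \<le> norm h / 2 ^ n" .
  qed (use \<alpha> in auto)
  also have "(norm h / 2 ^ n) powr (1 + \<alpha>) = norm h powr (1 + \<alpha>) * ((1 / 2) ^ n * ((1 / 2) powr \<alpha>) ^ n)"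
    by (rule dyadic_powr) simp
  finally show ?thesis by (simp add: power_divide field_simps)
qed

lemma half_powr_less_1: "(1 / 2) powr \<alpha> < 1"
  using \<alpha> powr_less_mono2[of \<alpha> "1 / 2" 1] by simp

text \<open>The quotients telescope into a geometrically dominated series. It starts at
  \<open>quotient x h 0 = g (x + h) - g x\<close>, so the bound on its sum is also the first-order
  Taylor estimate.\<close>

lemma quotient_tendsto: "quotient x h \<longlonglongrightarrow> derivative x h"
  and derivative_approx: "\<bar>g (x + h) - g x - derivative x h\<bar> \<le> remainder_const * norm h powr (1 + \<alpha>)"
proof -
  let ?r = "(1 / 2) powr \<alpha>"
  define c where "c = \<bar>B\<bar> * norm h powr (1 + \<alpha>)"
  define d where "d = (\<lambda>n. quotient x h (Suc n) - quotient x h n)"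
  have r: "norm ?r < 1" using half_powr_less_1 by simp
  have geo: "(\<lambda>n. c * ?r ^ n) sums (c * (1 / (1 - ?r)))"
    by (intro sums_mult geometric_sums r)
  have bound: "norm (d n) \<le> c * ?r ^ n" for n
    unfolding d_def c_def real_norm_def by (rule quotient_step)
  have d: "summable d" using summable_comparison_test'[OF sums_summable[OF geo]] bound by blast
  have eq: "quotient x h = (\<lambda>n. quotient x h 0 + (\<Sum>i<n. d i))"
    unfolding d_def by (simp add: sum_lessThan_telescope)
  have "(\<lambda>n. quotient x h 0 + (\<Sum>i<n. d i)) \<longlonglongrightarrow> quotient x h 0 + suminf d"
    by (intro tendsto_intros summable_LIMSEQ d)
  then have lim: "quotient x h \<longlonglongrightarrow> quotient x h 0 + suminf d" unfolding eq[symmetric] .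
  then have D: "derivative x h = quotient x h 0 + suminf d"
    unfolding derivative_def by (rule limI)
  show "quotient x h \<longlonglongrightarrow> derivative x h" using lim D by simp
  have "\<bar>suminf d\<bar> \<le> c * (1 / (1 - ?r))"
    using norm_suminf_le[OF bound sums_summable[OF geo]] unfolding sums_unique[OF geo] real_norm_def .
  then show "\<bar>g (x + h) - g x - derivative x h\<bar> \<le> remainder_const * norm h powr (1 + \<alpha>)"
    unfolding D by (simp add: quotient_def c_def remainder_const_def mult.commute)
qed

text \<open>At level \<open>n\<close> the additivity defect is \<open>2 ^ n\<close> times a
  parallelogram difference of side lengths proportional to \<open>1 / 2 ^ n\<close>, which tends to
  \<open>0\<close> because the exponent exceeds one.\<close>

lemma derivative_add: "derivative x (h + k) = derivative x h + derivative x k"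
proof -
  let ?s = "norm h + norm k"
  define q where "q = (\<lambda>n. quotient x h n + quotient x k n - quotient x (h + k) n)"
  have "q \<longlonglongrightarrow> derivative x h + derivative x k - derivative x (h + k)"
    unfolding q_def by (intro tendsto_intros quotient_tendsto)
  moreover have "q \<longlonglongrightarrow> 0"
  proof (rule Lim_null_comparison)
    have "norm (q n) \<le> 2 * \<bar>B\<bar> * ?s powr (1 + \<alpha>) * ((1 / 2) powr \<alpha>) ^ n" for n
    proof -
      let ?t = "1 / 2 ^ n :: real"
      have "q n = 2 ^ n * (g (x + ?t *\<^sub>R h) + g (x + ?t *\<^sub>R k) - g (x + ?t *\<^sub>R h + ?t *\<^sub>R k) - g x)"
        unfolding q_def quotient_def scaleR_add_right by (simp add: algebra_simps)
      then have "norm (q n) = 2 ^ n * \<bar>g (x + ?t *\<^sub>R h) + g (x + ?t *\<^sub>R k) - g (x + ?t *\<^sub>R h + ?t *\<^sub>R k) - g x\<bar>"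
        by (simp add: abs_mult)
      also have "\<dots> \<le> 2 ^ n * (2 * \<bar>B\<bar> * (?s * ?t) powr (1 + \<alpha>))"
      proof (intro mult_left_mono parallelogram_bound)
        have "norm (?t *\<^sub>R h) + norm (?t *\<^sub>R k) = ?s * ?t"
          by (simp add: add_divide_distrib)
        also have "\<dots> \<le> 2 * (?s * ?t)"
        proof -
          have "z \<le> 2 * z" if "0 \<le> z" for z :: real using that by simp
          from this[of "?s * ?t"] show ?thesis by simp
        qed
        finally show "norm (?t *\<^sub>R h) + norm (?t *\<^sub>R k) \<le> 2 * (?s * ?t)" .
      qed simp
      also have "(?s * ?t) powr (1 + \<alpha>) = ?s powr (1 + \<alpha>) * ((1 / 2) ^ n * ((1 / 2) powr \<alpha>) ^ n)"
        using dyadic_powr[of ?s n \<alpha>] by simp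
      finally show ?thesis by (simp add: power_divide field_simps)
    qed
    then show "\<forall>\<^sub>F n in sequentially. norm (q n) \<le> 2 * \<bar>B\<bar> * ?s powr (1 + \<alpha>) * ((1 / 2) powr \<alpha>) ^ n"
      by simp
    show "(\<lambda>n. 2 * \<bar>B\<bar> * ?s powr (1 + \<alpha>) * ((1 / 2) powr \<alpha>) ^ n) \<longlonglongrightarrow> 0"
      using half_powr_less_1 by (intro tendsto_mult_right_zero LIMSEQ_power_zero) simp
  qed
  ultimately show ?thesis using LIMSEQ_unique by fastforce
qed

lemma remainder_const_nonneg: "0 \<le> remainder_const"
  using half_powr_less_1 by (simp add: remainder_const_def)

text \<open>The bound on unit increments and the Taylor estimate bound the derivative on the unit
  ball, which upgrades additivity to bounded linearity.\<close>

lemma bounded_linear_derivative: "bounded_linear (derivative x)"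
  and derivative_bound: "\<bar>derivative x h\<bar> \<le> (M + remainder_const) * norm h"
proof -
  have bound: "\<bar>derivative x h\<bar> \<le> M + remainder_const" if h: "norm h \<le> 1" for h
  proof -
    have "remainder_const * norm h powr (1 + \<alpha>) \<le> remainder_const * 1"
      using h \<alpha> remainder_const_nonneg powr_mono2[of "1 + \<alpha>" "norm h" 1] by (intro mult_left_mono) auto
    with derivative_approx[of x h] unit_diff[OF h, of x] show ?thesis by linarith
  qed
  note linear = additive_bounded_imp_bounded_linear[of "derivative x" "M + remainder_const"]
  show "bounded_linear (derivative x)" by (rule linear(1)) (rule derivative_add, rule bound)
  show "\<bar>derivative x h\<bar> \<le> (M + remainder_const) * norm h"
    by (rule linear(2)) (rule derivative_add, rule bound)
qed

lemma has_derivative: "(g has_derivative derivative x) (at x)"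
  unfolding has_derivative_at
proof (intro conjI bounded_linear_derivative)
  show "(\<lambda>h. norm (g (x + h) - g x - derivative x h) / norm h) \<midarrow>0\<rightarrow> 0"
  proof (rule Lim_null_comparison)
    \<comment> \<open>One power of \<open>norm h\<close> cancels and the exponent
      \<open>\<alpha>\<close> is left; at \<open>h = 0\<close> the quotient is \<open>0\<close> by
      the convention for division.\<close>
    have "norm (norm (g (x + h) - g x - derivative x h) / norm h) \<le> remainder_const * norm h powr \<alpha>" for h
      using derivative_approx[of x h] by (cases "h = 0") (simp_all add: powr_add divide_simps mult_ac)
    then show "\<forall>\<^sub>F h in at 0. norm (norm (g (x + h) - g x - derivative x h) / norm h) \<le> remainder_const * norm h powr \<alpha>"
      by simp
    have "((\<lambda>h::'a. norm h powr \<alpha>) \<longlongrightarrow> norm (0::'a) powr \<alpha>) (at 0)"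
      using \<alpha> by (intro tendsto_powr2 tendsto_intros) auto
    then have "((\<lambda>h::'a. remainder_const * norm h powr \<alpha>) \<longlongrightarrow> remainder_const * 0) (at 0)"
      by (intro tendsto_mult_left) simp
    then show "((\<lambda>h::'a. remainder_const * norm h powr \<alpha>) \<longlongrightarrow> 0) (at 0)" by simp
  qed
qed

text \<open>Rescale \<open>h\<close> to a vector \<open>k\<close> with
  \<open>norm k = norm (x - y)\<close>. Then both Taylor remainders and the parallelogram difference
  with sides \<open>x - y\<close> and \<open>k\<close> are of the same order
  \<open>1 + \<alpha>\<close> in this length, and homogeneity returns to \<open>h\<close>.\<close>

lemma derivative_Hoelder:
  "\<bar>derivative x h - derivative y h\<bar> \<le> (2 * \<bar>B\<bar> + 2 * remainder_const) * norm (x - y) powr \<alpha> * norm h"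
proof (cases "x = y \<or> h = 0")
  case True
  then show ?thesis
    using remainder_const_nonneg derivative_bound[of x 0] derivative_bound[of y 0] by auto
next
  case False
  define r where "r = norm (x - y)"
  define k where "k = (r / norm h) *\<^sub>R h"
  have r: "0 < r" using False by (simp add: r_def)
  have nk: "norm k = r" using False r by (simp add: k_def)
  have "\<bar>g (y + (x - y)) + g (y + k) - g (y + (x - y) + k) - g y\<bar> \<le> 2 * \<bar>B\<bar> * r powr (1 + \<alpha>)"
    by (rule parallelogram_bound) (simp add: nk r_def[symmetric])
  then have "\<bar>g x + g (y + k) - g (x + k) - g y\<bar> \<le> 2 * \<bar>B\<bar> * r powr (1 + \<alpha>)" by simp
  moreover have "\<bar>g (x + k) - g x - derivative x k\<bar> \<le> remainder_const * r powr (1 + \<alpha>)"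
    "\<bar>g (y + k) - g y - derivative y k\<bar> \<le> remainder_const * r powr (1 + \<alpha>)"
    using derivative_approx[of _ k] unfolding nk by blast+
  ultimately have "\<bar>derivative x k - derivative y k\<bar>
      \<le> 2 * \<bar>B\<bar> * r powr (1 + \<alpha>) + 2 * (remainder_const * r powr (1 + \<alpha>))" by linarith
  also have "\<dots> = (2 * \<bar>B\<bar> + 2 * remainder_const) * r powr \<alpha> * r"
    using r by (simp add: powr_add algebra_simps)
  finally have *: "\<bar>derivative x k - derivative y k\<bar> \<le> (2 * \<bar>B\<bar> + 2 * remainder_const) * r powr \<alpha> * r" .
  have "derivative z k = (r / norm h) * derivative z h" for z
    unfolding k_def using bounded_linear_derivative
    by (simp add: linear_simps(5) bounded_linear.linear linear_cmul)
  then have "derivative x k - derivative y k = (r / norm h) * (derivative x h - derivative y h)"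
    by (simp add: right_diff_distrib)
  then have "\<bar>derivative x k - derivative y k\<bar> = r / norm h * \<bar>derivative x h - derivative y h\<bar>"
    using r by (simp add: abs_mult)
  with * have "r / norm h * \<bar>derivative x h - derivative y h\<bar>
      \<le> r / norm h * ((2 * \<bar>B\<bar> + 2 * remainder_const) * r powr \<alpha> * norm h)"
    using False by (simp add: mult_ac)
  moreover have "0 < r / norm h" using r False by simp
  ultimately show ?thesis unfolding r_def[symmetric] by (rule mult_left_le_imp_le)
qed

lemma in_C1: "g \<in> C1 \<alpha>"
proof -
  let ?D = "\<lambda>x. Blinfun (derivative x)"
  have D: "blinfun_apply (?D x) = derivative x" for x
    by (rule bounded_linear_Blinfun_apply[OF bounded_linear_derivative])
  have "norm (?D x - ?D y) / norm (x - y) powr \<alpha> \<le> 2 * \<bar>B\<bar> + 2 * remainder_const" if "x \<noteq> y" for x y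
  proof -
    have "norm (?D x - ?D y) \<le> (2 * \<bar>B\<bar> + 2 * remainder_const) * norm (x - y) powr \<alpha>"
      using derivative_Hoelder[of x _ y] remainder_const_nonneg
      by (intro norm_blinfun_bound) (auto simp: blinfun.diff_left D)
    then show ?thesis using that by (simp add: divide_simps)
  qed
  then show ?thesis
    unfolding C1_def using has_derivative D by (auto intro!: exI[of _ ?D])
qed

lemma in_Lip: "g \<in> Lip"
proof -
  have "(M + remainder_const)-lipschitz_on UNIV g"
  proof (rule bounded_derivative_imp_lipschitz)
    show "(g has_derivative derivative x) (at x within UNIV)" for x using has_derivative by simp
    show "onorm (derivative x) \<le> M + remainder_const" for x
      using derivative_bound by (intro onorm_bound) (use unit_diff[of 0 0] remainder_const_nonneg in auto)
    show "0 \<le> M + remainder_const" using unit_diff[of 0 0] remainder_const_nonneg by simp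
  qed simp
  then show ?thesis by (auto simp: Lip_def)
qed

end

section \<open>Oscillations\<close>

text \<open>Removes extended suprema in favour of pointwise bounds. As the supremum of values at
  most \<open>e\<close> may equal \<open>e\<close>, the converse starts from \<open>r / 2\<close> to
  get strict inequality.\<close>

lemma tendsto_zero_SUP_ennreal_iff:
  fixes F :: "'c \<Rightarrow> real"
  shows "((\<lambda>d. SUP z\<in>S d. ennreal (F z)) \<longlongrightarrow> 0) A \<longleftrightarrow> (\<forall>e>0. \<forall>\<^sub>F d in A. \<forall>z\<in>S d. F z \<le> e)"
proof (intro iffI allI impI)
  fix e :: real
  assume "((\<lambda>d. SUP z\<in>S d. ennreal (F z)) \<longlongrightarrow> 0) A" "0 < e"
  then have "\<forall>\<^sub>F d in A. (SUP z\<in>S d. ennreal (F z)) < ennreal e"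
    by (intro order_tendstoD) auto
  then show "\<forall>\<^sub>F d in A. \<forall>z\<in>S d. F z \<le> e"
  proof (rule eventually_mono, intro ballI)
    fix d z assume "(SUP z\<in>S d. ennreal (F z)) < ennreal e" "z \<in> S d"
    then have "ennreal (F z) \<le> ennreal e" by (meson SUP_upper order_trans less_imp_le)
    then show "F z \<le> e" using \<open>0 < e\<close> by (simp add: ennreal_le_iff)
  qed
next
  assume *: "\<forall>e>0. \<forall>\<^sub>F d in A. \<forall>z\<in>S d. F z \<le> e"
  show "((\<lambda>d. SUP z\<in>S d. ennreal (F z)) \<longlongrightarrow> 0) A"
  proof (rule tendsto_zero_ennreal)
    fix r :: real assume r: "0 < r"
    then have "\<forall>\<^sub>F d in A. \<forall>z\<in>S d. F z \<le> r / 2" by (intro *[rule_format]) simp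
    then show "\<forall>\<^sub>F d in A. (SUP z\<in>S d. ennreal (F z)) < ennreal r"
    proof (rule eventually_mono)
      fix d assume "\<forall>z\<in>S d. F z \<le> r / 2"
      then have "(SUP z\<in>S d. ennreal (F z)) \<le> ennreal (r / 2)"
        by (intro SUP_least ennreal_leI) auto
      also have "\<dots> < ennreal r" using r by (intro ennreal_lessI) auto
      finally show "(SUP z\<in>S d. ennreal (F z)) < ennreal r" .
    qed
  qed
qed

text \<open>The segment from \<open>y\<close> to \<open>x\<close> stays in \<open>S\<close> by
  convexity and is cut into equal pieces of length at most \<open>t\<close>; rounding their number
  up costs the \<open>+ 1\<close>.\<close>

lemma chain_bound:
  fixes f :: "'a::real_normed_vector \<Rightarrow> real"
  assumes "convex S" "x \<in> S" "y \<in> S" "0 < t"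
    and "\<And>u v. u \<in> S \<Longrightarrow> v \<in> S \<Longrightarrow> norm (u - v) \<le> t \<Longrightarrow> \<bar>f u - f v\<bar> \<le> b"
  shows "\<bar>f x - f y\<bar> \<le> (norm (x - y) / t + 1) * b"
proof -
  have b: "0 \<le> b" using assms(2,4) assms(5)[of x x] by simp
  have "\<bar>f x - f y\<bar> \<le> real n * b" if "y \<in> S" "norm (x - y) \<le> real n * t" for n y
    using that
  proof (induction n arbitrary: y)
    case 0
    then show ?case by simp
  next
    case (Suc n)
    \<comment> \<open>One of the \<open>Suc n\<close> equal steps from \<open>y\<close> towards
      \<open>x\<close>; the induction hypothesis covers the rest, hence the generalization over
      \<open>y\<close>.\<close>
    define z where "z = y + (1 / real (Suc n)) *\<^sub>R (x - y)"
    have z: "z = (1 - 1 / real (Suc n)) *\<^sub>R y + (1 / real (Suc n)) *\<^sub>R x"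
      by (simp add: z_def scaleR_diff_left scaleR_diff_right)
    have "z \<in> S"
      unfolding z by (rule convexD[OF assms(1) Suc.prems(1) assms(2)]) auto
    moreover have "norm (x - z) \<le> real n * t"
    proof -
      have "x - z = (1 - 1 / real (Suc n)) *\<^sub>R (x - y)"
        by (simp add: z scaleR_diff_left scaleR_diff_right)
      also have "1 - 1 / real (Suc n) = real n / real (Suc n)" by (simp add: field_simps)
      finally have "norm (x - z) = real n / real (Suc n) * norm (x - y)" by simp
      also have "\<dots> \<le> real n / real (Suc n) * (real (Suc n) * t)"
        using Suc.prems(2) by (intro mult_left_mono) auto
      finally show ?thesis by simp
    qed
    ultimately have "\<bar>f x - f z\<bar> \<le> real n * b" by (rule Suc.IH)
    moreover have "norm (z - y) \<le> t"
      using Suc.prems(2) by (simp add: z_def divide_le_eq mult.commute)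
    then have "\<bar>f z - f y\<bar> \<le> b" using \<open>z \<in> S\<close> Suc.prems(1) by (intro assms(5))
    ultimately show ?case by (simp add: distrib_right)
  qed
  moreover define n where "n = nat \<lceil>norm (x - y) / t\<rceil>"
  moreover have n: "norm (x - y) / t \<le> real n" "real n \<le> norm (x - y) / t + 1"
    using assms(4) unfolding n_def by (simp_all add: of_nat_ceiling)
  moreover have "norm (x - y) \<le> real n * t" using n(1) assms(4) by (simp add: divide_le_eq)
  ultimately have "\<bar>f x - f y\<bar> \<le> real n * b" using assms(3) by blast
  also have "\<dots> \<le> (norm (x - y) / t + 1) * b" using n(2) b by (rule mult_right_mono)
  finally show ?thesis .
qed

section \<open>Moduli and pairwise forms of the vanishing conditions\<close>

locale modulus =
  fixes \<omega> :: "real \<Rightarrow> real"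
  assumes \<omega>_pos: "0 < t \<Longrightarrow> 0 < \<omega> t"
    and mono_on_\<omega>: "mono_on {0<..} \<omega>"
    and \<omega>_at_top: "filterlim \<omega> at_top at_top"
    and quotient_\<omega>: "((\<lambda>t. t / \<omega> t) \<longlongrightarrow> 0) (at_right 0)"
begin

text \<open>The bound is multiplied out to avoid quotients. At \<open>x = y\<close> it would concern
  \<open>\<omega> 0\<close>, about which nothing is assumed; hence the recurring
  \<open>x \<noteq> y\<close>.\<close>

definition osc_le :: "real \<Rightarrow> ('a::real_normed_vector \<Rightarrow> real) \<Rightarrow> 'a \<Rightarrow> 'a \<Rightarrow> bool" where
  "osc_le e f x y \<longleftrightarrow> \<bar>f x - f y\<bar> \<le> e * \<omega> (norm (x - y))"

lemma \<omega>_mono: "0 < s \<Longrightarrow> s \<le> t \<Longrightarrow> \<omega> s \<le> \<omega> t"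
  using mono_on_\<omega> by (auto simp: mono_on_def)

lemma id_le_small:
  assumes "0 < e"
  shows "\<exists>d>0. \<forall>t. 0 < t \<longrightarrow> t < d \<longrightarrow> t \<le> e * \<omega> t"
proof -
  have "\<forall>\<^sub>F t in at_right 0. t / \<omega> t < e" using quotient_\<omega> assms by (rule order_tendstoD)
  then obtain d where d: "0 < d" "\<And>t. 0 < t \<Longrightarrow> t < d \<Longrightarrow> t / \<omega> t < e"
    unfolding eventually_at_right_field by blast
  show ?thesis
  proof (intro exI[of _ d] conjI allI impI d(1))
    fix t assume t: "0 < t" "t < d"
    show "t \<le> e * \<omega> t" using d(2)[OF t] \<omega>_pos[OF t(1)] by (simp add: divide_less_eq)
  qed
qed

lemma id_le_bounded: "\<exists>c>0. \<forall>t. 0 < t \<longrightarrow> t \<le> T \<longrightarrow> t \<le> c * \<omega> t"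
proof -
  obtain d where d: "0 < d" "\<And>t. 0 < t \<Longrightarrow> t < d \<Longrightarrow> t \<le> 1 * \<omega> t"
    using id_le_small[OF zero_less_one] by blast
  \<comment> \<open>The \<open>1\<close> serves below \<open>d\<close>; on the rest, up to
    \<open>T\<close>, monotonicity gives \<open>\<omega> d \<le> \<omega> t\<close>, so that
    \<open>T / \<omega> d\<close> suffices.\<close>
  define c where "c = max 1 (T / \<omega> d)"
  show ?thesis
  proof (intro exI[of _ c] conjI allI impI)
    show "0 < c" by (simp add: c_def)
    fix t assume t: "0 < t" "t \<le> T"
    show "t \<le> c * \<omega> t"
    proof (cases "t < d")
      case True
      have "t \<le> 1 * \<omega> t" using d(2) t(1) True .
      also have "\<dots> \<le> c * \<omega> t" using \<omega>_pos[OF t(1)] by (intro mult_right_mono) (auto simp: c_def)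
      finally show ?thesis .
    next
      case False
      have "t \<le> (T / \<omega> d) * \<omega> d" using t \<omega>_pos[OF d(1)] by simp
      also have "\<dots> \<le> c * \<omega> t"
        using False d(1) \<omega>_pos[OF d(1)] by (intro mult_mono \<omega>_mono) (auto simp: c_def)
      finally show ?thesis .
    qed
  qed
qed

lemma \<omega>_large: "\<exists>T>0. T\<^sub>0 \<le> T \<and> (\<forall>t\<ge>T. b \<le> \<omega> t)"
proof -
  obtain T where T: "\<And>t. T \<le> t \<Longrightarrow> b \<le> \<omega> t"
    using \<omega>_at_top unfolding filterlim_at_top eventually_at_top_linorder by blast
  show ?thesis by (intro exI[of _ "max T (max T\<^sub>0 1)"]) (use T in auto)
qed

lemma osc_le_iff: "x \<noteq> y \<Longrightarrow> osc \<omega> f x y \<le> e \<longleftrightarrow> osc_le e f x y"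
  unfolding osc_def osc_le_def by (rule pos_divide_le_eq) (simp add: \<omega>_pos)

lemma osc_le_mono:
  assumes "osc_le e f x y" "e \<le> e'" "x \<noteq> y"
  shows "osc_le e' f x y"
proof -
  have "e * \<omega> (norm (x - y)) \<le> e' * \<omega> (norm (x - y))"
    using assms(2,3) by (intro mult_right_mono less_imp_le[OF \<omega>_pos]) auto
  with assms(1) show ?thesis by (simp add: osc_le_def)
qed

lemma osc_le_add:
  assumes "osc_le e f x y" "osc_le e' (\<lambda>x. g x - f x) x y"
  shows "osc_le (e + e') g x y"
  using assms unfolding osc_le_def distrib_right by argo

lemma osc_le_diff_commute: "osc_le e (\<lambda>x. f x - g x) x y \<longleftrightarrow> osc_le e (\<lambda>x. g x - f x) x y"
proof -
  have "\<bar>(f x - g x) - (f y - g y)\<bar> = \<bar>(g x - f x) - (g y - f y)\<bar>" by argo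
  then show ?thesis unfolding osc_le_def by simp
qed

lemma C0_seminorm_le_iff:
  "0 \<le> e \<Longrightarrow> C0_seminorm \<omega> f \<le> ennreal e \<longleftrightarrow> (\<forall>x y. x \<noteq> y \<longrightarrow> osc_le e f x y)"
  unfolding C0_seminorm_def SUP_le_iff by (auto simp: osc_le_iff)

lemma C0_dot_iff: "f \<in> C0_dot \<omega> \<longleftrightarrow> (\<exists>A>0. \<forall>x y. x \<noteq> y \<longrightarrow> osc_le A f x y)"
proof
  assume "f \<in> C0_dot \<omega>"
  then have "C0_seminorm \<omega> f < top" by (simp add: C0_dot_def)
  then obtain A where A: "C0_seminorm \<omega> f = ennreal A" "0 \<le> A" by (cases "C0_seminorm \<omega> f") auto
  have "C0_seminorm \<omega> f \<le> ennreal (A + 1)" unfolding A(1) by (rule ennreal_leI) simp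
  with A(2) have "\<forall>x y. x \<noteq> y \<longrightarrow> osc_le (A + 1) f x y" by (subst (asm) C0_seminorm_le_iff) auto
  with A(2) show "\<exists>A>0. \<forall>x y. x \<noteq> y \<longrightarrow> osc_le A f x y" by (intro exI[of _ "A + 1"]) simp
next
  assume "\<exists>A>0. \<forall>x y. x \<noteq> y \<longrightarrow> osc_le A f x y"
  then obtain A where A: "0 < A" "\<forall>x y. x \<noteq> y \<longrightarrow> osc_le A f x y" by blast
  then have "C0_seminorm \<omega> f \<le> ennreal A" using C0_seminorm_le_iff[of A f] by simp
  also have "\<dots> < top" by simp
  finally show "f \<in> C0_dot \<omega>" by (simp add: C0_dot_def)
qed

text \<open>Approximants for \<open>e = 1 / real (Suc n)\<close> form the required sequence, so all
  later approximation is for one fixed \<open>e\<close>.\<close>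

lemma C0_closure_iff:
  "f \<in> C0_closure \<omega> \<C> \<longleftrightarrow>
    f \<in> C0_dot \<omega> \<and> (\<forall>e>0. \<exists>g\<in>\<C>. \<forall>x y. x \<noteq> y \<longrightarrow> osc_le e (\<lambda>x. g x - f x) x y)"
proof (intro iffI conjI allI impI)
  assume "f \<in> C0_closure \<omega> \<C>"
  then obtain F where F: "f \<in> C0_dot \<omega>" "\<And>n. F n \<in> \<C>"
    "(\<lambda>n. C0_seminorm \<omega> (\<lambda>x. F n x - f x)) \<longlonglongrightarrow> 0"
    by (auto simp: C0_closure_def)
  show "f \<in> C0_dot \<omega>" by (rule F(1))
  fix e :: real assume e: "0 < e"
  then have "\<forall>\<^sub>F n in sequentially. C0_seminorm \<omega> (\<lambda>x. F n x - f x) < ennreal e"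
    by (intro order_tendstoD(2)[OF F(3)]) simp
  then obtain n where "C0_seminorm \<omega> (\<lambda>x. F n x - f x) < ennreal e"
    using eventually_happens by fastforce
  then show "\<exists>g\<in>\<C>. \<forall>x y. x \<noteq> y \<longrightarrow> osc_le e (\<lambda>x. g x - f x) x y"
    using F(2) e C0_seminorm_le_iff[of e "\<lambda>x. F n x - f x"] by (intro bexI[of _ "F n"]) auto
next
  assume *: "f \<in> C0_dot \<omega> \<and> (\<forall>e>0. \<exists>g\<in>\<C>. \<forall>x y. x \<noteq> y \<longrightarrow> osc_le e (\<lambda>x. g x - f x) x y)"
  have "\<exists>g\<in>\<C>. C0_seminorm \<omega> (\<lambda>x. g x - f x) \<le> ennreal (1 / real (Suc n))" for n
  proof -
    have "0 < 1 / real (Suc n)" by simp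
    then show ?thesis using * C0_seminorm_le_iff[OF less_imp_le] by metis
  qed
  then obtain F where F: "\<And>n. F n \<in> \<C>"
    "\<And>n. C0_seminorm \<omega> (\<lambda>x. F n x - f x) \<le> ennreal (1 / real (Suc n))" by metis
  have "(\<lambda>n. C0_seminorm \<omega> (\<lambda>x. F n x - f x)) \<longlonglongrightarrow> 0"
  proof (rule tendsto_sandwich[OF _ _ tendsto_const])
    have "(\<lambda>n. ennreal (1 / real (Suc n))) \<longlonglongrightarrow> ennreal 0"
      by (intro tendsto_ennrealI LIMSEQ_inverse_real_of_nat[unfolded inverse_eq_divide])
    then show "(\<lambda>n. ennreal (1 / real (Suc n))) \<longlonglongrightarrow> 0" by simp
  qed (use F(2) in auto)
  with * F(1) show "f \<in> C0_closure \<omega> \<C>" unfolding C0_closure_def by blast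
qed

lemma VC_small_iff:
  fixes f :: "'a::real_normed_vector \<Rightarrow> real"
  shows "f \<in> VC_small \<omega> \<longleftrightarrow>
    f \<in> C0_dot \<omega> \<and> (\<forall>e>0. \<exists>d>0. \<forall>x y. x \<noteq> y \<longrightarrow> norm (x - y) < d \<longrightarrow> osc_le e f x y)"
proof -
  have "(osc_at \<omega> f \<longlongrightarrow> 0) (at_right 0) \<longleftrightarrow>
      (\<forall>e>0. \<exists>d>0. \<forall>t>0. t < d \<longrightarrow> (\<forall>x y. norm (x - y) = t \<longrightarrow> osc \<omega> f x y \<le> e))"
    unfolding osc_at_def[abs_def] case_prod_unfold tendsto_zero_SUP_ennreal_iff eventually_at_right_field
    by auto
  also have "\<dots> \<longleftrightarrow> (\<forall>e>0. \<exists>d>0. \<forall>x y. x \<noteq> y \<longrightarrow> norm (x - y) < d \<longrightarrow> osc_le e f x y)"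
  proof -
    have "(\<forall>t>0. t < d \<longrightarrow> (\<forall>x y. norm (x - y) = t \<longrightarrow> osc \<omega> f x y \<le> e)) \<longleftrightarrow>
        (\<forall>x y. x \<noteq> y \<longrightarrow> norm (x - y) < d \<longrightarrow> osc_le e f x y)" for d e
      using osc_le_iff[of _ _ f e] by (metis norm_eq_zero right_minus_eq zero_less_norm_iff)
    then show ?thesis by simp
  qed
  finally show ?thesis by (simp add: VC_small_def)
qed

lemma VC_large_iff:
  fixes f :: "'a::real_normed_vector \<Rightarrow> real"
  shows "f \<in> VC_large \<omega> \<longleftrightarrow>
    f \<in> C0_dot \<omega> \<and> (\<forall>e>0. \<exists>T>0. \<forall>x y. T \<le> norm (x - y) \<longrightarrow> osc_le e f x y)"
proof -
  have "(osc_at \<omega> f \<longlongrightarrow> 0) at_top \<longleftrightarrow>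
      (\<forall>e>0. \<exists>T. \<forall>t\<ge>T. \<forall>x y. norm (x - y) = t \<longrightarrow> osc \<omega> f x y \<le> e)"
    unfolding osc_at_def[abs_def] case_prod_unfold tendsto_zero_SUP_ennreal_iff eventually_at_top_linorder
    by auto
  also have "\<dots> \<longleftrightarrow> (\<forall>e>0. \<exists>T>0. \<forall>x y. T \<le> norm (x - y) \<longrightarrow> osc_le e f x y)"
  proof (intro iffI allI impI)
    fix e :: real
    assume "\<forall>e>0. \<exists>T. \<forall>t\<ge>T. \<forall>x y. norm (x - y) = t \<longrightarrow> osc \<omega> f x y \<le> e" "0 < e"
    then obtain T where T: "\<And>x y. T \<le> norm (x - y) \<Longrightarrow> osc \<omega> f x y \<le> e" by blast
    \<comment> \<open>The \<open>T\<close> obtained may be nonpositive; the maximum with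
      \<open>1\<close> forces \<open>x \<noteq> y\<close>.\<close>
    have "osc_le e f x y" if "max T 1 \<le> norm (x - y)" for x y
    proof -
      have "x \<noteq> y" using that by auto
      with T[of x y] that show ?thesis by (simp add: osc_le_iff)
    qed
    then show "\<exists>T>0. \<forall>x y. T \<le> norm (x - y) \<longrightarrow> osc_le e f x y"
      by (intro exI[of _ "max T 1"]) auto
  next
    fix e :: real
    assume "\<forall>e>0. \<exists>T>0. \<forall>x y. T \<le> norm (x - y) \<longrightarrow> osc_le e f x y" "0 < e"
    then obtain T where T: "0 < T" "\<And>x y. T \<le> norm (x - y) \<Longrightarrow> osc_le e f x y" by blast
    have "osc \<omega> f x y \<le> e" if "T \<le> norm (x - y)" for x y
    proof -
      have "x \<noteq> y" using that T(1) by auto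
      with T(2)[OF that] show ?thesis by (simp add: osc_le_iff)
    qed
    then show "\<exists>T. \<forall>t\<ge>T. \<forall>x y. norm (x - y) = t \<longrightarrow> osc \<omega> f x y \<le> e" by blast
  qed
  finally show ?thesis by (simp add: VC_large_def)
qed

lemma VC_far_iff:
  fixes f :: "'a::real_normed_vector \<Rightarrow> real"
  shows "f \<in> VC_far \<omega> \<longleftrightarrow>
    f \<in> C0_dot \<omega> \<and>
    (\<forall>e>0. \<exists>R>0. \<forall>x y. x \<noteq> y \<longrightarrow> R < norm x \<longrightarrow> R < norm y \<longrightarrow> osc_le e f x y)"
proof -
  have "(osc_far \<omega> f \<longlongrightarrow> 0) at_top \<longleftrightarrow>
      (\<forall>e>0. \<exists>R. \<forall>r\<ge>R. \<forall>x y. x \<noteq> y \<and> r < norm x \<and> r < norm y \<longrightarrow> osc \<omega> f x y \<le> e)"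
    unfolding osc_far_def[abs_def] case_prod_unfold tendsto_zero_SUP_ennreal_iff eventually_at_top_linorder
    by auto
  also have "\<dots> \<longleftrightarrow>
      (\<forall>e>0. \<exists>R>0. \<forall>x y. x \<noteq> y \<longrightarrow> R < norm x \<longrightarrow> R < norm y \<longrightarrow> osc_le e f x y)"
  proof (intro iffI allI impI)
    fix e :: real
    assume "\<forall>e>0. \<exists>R. \<forall>r\<ge>R. \<forall>x y. x \<noteq> y \<and> r < norm x \<and> r < norm y \<longrightarrow> osc \<omega> f x y \<le> e" "0 < e"
    then obtain R where "\<forall>r\<ge>R. \<forall>x y. x \<noteq> y \<and> r < norm x \<and> r < norm y \<longrightarrow> osc \<omega> f x y \<le> e" by blast
    from this[rule_format, of "max R 1"]
    show "\<exists>R>0. \<forall>x y. x \<noteq> y \<longrightarrow> R < norm x \<longrightarrow> R < norm y \<longrightarrow> osc_le e f x y"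
      by (intro exI[of _ "max R 1"]) (auto simp: osc_le_iff)
  next
    fix e :: real
    assume "\<forall>e>0. \<exists>R>0. \<forall>x y. x \<noteq> y \<longrightarrow> R < norm x \<longrightarrow> R < norm y \<longrightarrow> osc_le e f x y" "0 < e"
    then obtain R where R: "\<And>x y. x \<noteq> y \<Longrightarrow> R < norm x \<Longrightarrow> R < norm y \<Longrightarrow> osc_le e f x y" by blast
    show "\<exists>R. \<forall>r\<ge>R. \<forall>x y. x \<noteq> y \<and> r < norm x \<and> r < norm y \<longrightarrow> osc \<omega> f x y \<le> e"
    proof (intro exI[of _ R] allI impI)
      fix r and x y :: 'a assume "R \<le> r" "x \<noteq> y \<and> r < norm x \<and> r < norm y"
      then show "osc \<omega> f x y \<le> e" using R[of x y] by (simp add: osc_le_iff)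
    qed
  qed
  finally show ?thesis by (simp add: VC_far_def)
qed

end

section \<open>Closedness of the vanishing classes\<close>

lemma Lip_imp_abs_diff_le:
  assumes "f \<in> Lip"
  shows "\<exists>L>0. \<forall>x y. \<bar>f x - f y\<bar> \<le> L * norm (x - y)"
proof -
  obtain L where L: "L-lipschitz_on UNIV f" using assms by (auto simp: Lip_def)
  show ?thesis
  proof (intro exI[of _ "L + 1"] conjI allI)
    show "0 < L + 1" using lipschitz_on_nonneg[OF L] by simp
    fix x y
    have "\<bar>f x - f y\<bar> \<le> L * norm (x - y)"
      using lipschitz_onD[OF L, of x y] by (simp add: dist_norm)
    also have "\<dots> \<le> (L + 1) * norm (x - y)" by (intro mult_right_mono) auto
    finally show "\<bar>f x - f y\<bar> \<le> (L + 1) * norm (x - y)" .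
  qed
qed

context modulus
begin

lemma C0_closure_mono: "\<C> \<subseteq> \<D> \<Longrightarrow> C0_closure \<omega> \<C> \<subseteq> C0_closure \<omega> \<D>"
  unfolding C0_closure_def by blast

lemma osc_le_trans:
  assumes "\<And>x y. x \<noteq> y \<Longrightarrow> osc_le (e / 2) (\<lambda>x. g x - f x) x y" "osc_le (e / 2) g x y" "x \<noteq> y"
  shows "osc_le e f x y"
proof -
  have "osc_le (e / 2) (\<lambda>x. f x - g x) x y"
    using assms(1)[OF assms(3)] by (subst osc_le_diff_commute)
  from osc_le_add[OF assms(2) this] show ?thesis by simp
qed

text \<open>The seminorm controls the oscillation of the error at all pairs at once, so half of
  \<open>e\<close> goes to the error and half to the approximant.\<close>

lemma C0_closure_VC_small_subset: "C0_closure \<omega> (VC_small \<omega>) \<subseteq> VC_small \<omega>"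
proof
  fix f :: "'a \<Rightarrow> real" assume f: "f \<in> C0_closure \<omega> (VC_small \<omega>)"
  show "f \<in> VC_small \<omega>"
    unfolding VC_small_iff
  proof (intro conjI allI impI)
    show "f \<in> C0_dot \<omega>" using f by (simp add: C0_closure_iff)
    fix e :: real assume e: "0 < e"
    then have e2: "0 < e / 2" by simp
    obtain g where g: "g \<in> VC_small \<omega>" "\<And>x y. x \<noteq> y \<Longrightarrow> osc_le (e / 2) (\<lambda>x. g x - f x) x y"
      using f e2 unfolding C0_closure_iff by blast
    obtain d where d: "0 < d" "\<And>x y. x \<noteq> y \<Longrightarrow> norm (x - y) < d \<Longrightarrow> osc_le (e / 2) g x y"
      using g(1) e2 unfolding VC_small_iff by blast
    show "\<exists>d>0. \<forall>x y. x \<noteq> y \<longrightarrow> norm (x - y) < d \<longrightarrow> osc_le e f x y"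
      using d osc_le_trans[OF g(2)] by blast
  qed
qed

lemma C0_closure_VC_subset: "C0_closure \<omega> (VC \<omega>) \<subseteq> VC \<omega>"
proof
  fix f :: "'a \<Rightarrow> real" assume f: "f \<in> C0_closure \<omega> (VC \<omega>)"
  then have C0: "f \<in> C0_dot \<omega>" by (simp add: C0_closure_iff)
  have approx: "\<exists>g\<in>VC \<omega>. \<forall>x y. x \<noteq> y \<longrightarrow> osc_le (e / 2) (\<lambda>x. g x - f x) x y" if "0 < e" for e
    using f half_gt_zero[OF that] unfolding C0_closure_iff by blast
  have "VC \<omega> \<subseteq> (VC_small \<omega> :: ('a \<Rightarrow> real) set)" by (auto simp: VC_def)
  with f C0_closure_mono[of "VC \<omega>" "VC_small \<omega>"] have "f \<in> VC_small \<omega>"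
    using C0_closure_VC_small_subset by blast
  moreover have "f \<in> VC_large \<omega>"
    unfolding VC_large_iff
  proof (intro conjI allI impI C0)
    fix e :: real assume e: "0 < e"
    obtain g where g: "g \<in> VC_large \<omega>" "\<And>x y. x \<noteq> y \<Longrightarrow> osc_le (e / 2) (\<lambda>x. g x - f x) x y"
      using approx[OF e] unfolding VC_def by blast
    obtain T where T: "0 < T" "\<And>x y. T \<le> norm (x - y) \<Longrightarrow> osc_le (e / 2) g x y"
      using g(1) half_gt_zero[OF e] unfolding VC_large_iff by blast
    have "osc_le e f x y" if t: "T \<le> norm (x - y)" for x y
    proof -
      have "x \<noteq> y" using t T(1) by auto
      with osc_le_trans[OF g(2) T(2)[OF t]] show ?thesis by blast
    qed
    with T(1) show "\<exists>T>0. \<forall>x y. T \<le> norm (x - y) \<longrightarrow> osc_le e f x y" by blast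
  qed
  moreover have "f \<in> VC_far \<omega>"
    unfolding VC_far_iff
  proof (intro conjI allI impI C0)
    fix e :: real assume e: "0 < e"
    obtain g where g: "g \<in> VC_far \<omega>" "\<And>x y. x \<noteq> y \<Longrightarrow> osc_le (e / 2) (\<lambda>x. g x - f x) x y"
      using approx[OF e] unfolding VC_def by blast
    obtain R where R: "0 < R"
      "\<And>x y. x \<noteq> y \<Longrightarrow> R < norm x \<Longrightarrow> R < norm y \<Longrightarrow> osc_le (e / 2) g x y"
      using g(1) half_gt_zero[OF e] unfolding VC_far_iff by blast
    show "\<exists>R>0. \<forall>x y. x \<noteq> y \<longrightarrow> R < norm x \<longrightarrow> R < norm y \<longrightarrow> osc_le e f x y"
      using R osc_le_trans[OF g(2)] by blast
  qed
  ultimately show "f \<in> VC \<omega>" by (simp add: VC_def)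
qed

text \<open>A linear modulus is negligible against \<open>\<omega>\<close> at
  \<open>0\<close>.\<close>

lemma Lip_subset_VC_small: "Lip \<inter> C0_dot \<omega> \<subseteq> VC_small \<omega>"
proof
  fix f :: "'a \<Rightarrow> real" assume f: "f \<in> Lip \<inter> C0_dot \<omega>"
  then obtain L where L: "0 < L" "\<And>x y. \<bar>f x - f y\<bar> \<le> L * norm (x - y)"
    using Lip_imp_abs_diff_le[of f] by blast
  show "f \<in> VC_small \<omega>"
    unfolding VC_small_iff
  proof (intro conjI allI impI)
    show "f \<in> C0_dot \<omega>" using f by simp
    fix e :: real assume "0 < e"
    then obtain d where d: "0 < d" "\<And>t. 0 < t \<Longrightarrow> t < d \<Longrightarrow> t \<le> e / L * \<omega> t"
      using id_le_small[OF divide_pos_pos[OF _ L(1)], of e] by blast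
    have "osc_le e f x y" if "x \<noteq> y" "norm (x - y) < d" for x y
    proof -
      have "L * norm (x - y) \<le> L * (e / L * \<omega> (norm (x - y)))"
        using d(2)[of "norm (x - y)"] that L(1) by (intro mult_left_mono) auto
      with L(2)[of x y] L(1) show ?thesis by (simp add: osc_le_def)
    qed
    with d(1) show "\<exists>d>0. \<forall>x y. x \<noteq> y \<longrightarrow> norm (x - y) < d \<longrightarrow> osc_le e f x y" by blast
  qed
qed

text \<open>Short distances are handled by the Lipschitz bound, long ones by \<open>2 * M\<close>
  against the growth of \<open>\<omega>\<close>, and far pairs trivially, both values being
  \<open>0\<close>.\<close>

lemma bounded_support_in_VC:
  assumes f: "f \<in> Lip" and M: "\<And>x. \<bar>f x\<bar> \<le> M" and R: "\<And>x. x \<notin> ball 0 R \<Longrightarrow> f x = 0"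
  shows "f \<in> VC \<omega>"
proof -
  have M0: "0 \<le> M" using M[of undefined] by linarith
  have diff: "\<bar>f x - f y\<bar> \<le> 2 * M" for x y using M[of x] M[of y] by linarith
  obtain L where L: "0 < L" "\<And>x y. \<bar>f x - f y\<bar> \<le> L * norm (x - y)"
    using Lip_imp_abs_diff_le[OF f] by blast
  have C0: "f \<in> C0_dot \<omega>"
  proof -
    obtain c where c: "0 < c" "\<And>t. 0 < t \<Longrightarrow> t \<le> 1 \<Longrightarrow> t \<le> c * \<omega> t"
      using id_le_bounded[of 1] by blast
    \<comment> \<open>The sum of the constants that serve at distances up to \<open>1\<close> and
      beyond \<open>1\<close>.\<close>
    define A where "A = L * c + 2 * M / \<omega> 1"
    have \<omega>1: "0 < \<omega> 1" by (simp add: \<omega>_pos)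
    have A: "0 < L * c" "0 \<le> 2 * M / \<omega> 1" using L(1) c(1) M0 \<omega>1 by simp_all
    have "osc_le A f x y" if "x \<noteq> y" for x y
    proof (cases "norm (x - y) \<le> 1")
      case True
      have "\<bar>f x - f y\<bar> \<le> L * norm (x - y)" by (rule L(2))
      also have "\<dots> \<le> L * (c * \<omega> (norm (x - y)))"
        using c(2)[of "norm (x - y)"] True that L(1) by (intro mult_left_mono) auto
      finally have "osc_le (L * c) f x y" by (simp add: osc_le_def mult.assoc)
      then show ?thesis by (rule osc_le_mono) (use A that in \<open>auto simp: A_def\<close>)
    next
      case False
      have "\<bar>f x - f y\<bar> \<le> 2 * M / \<omega> 1 * \<omega> 1" using diff[of x y] \<omega>1 by simp
      also have "\<dots> \<le> 2 * M / \<omega> 1 * \<omega> (norm (x - y))"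
        using False A(2) by (intro mult_left_mono \<omega>_mono) auto
      finally have "osc_le (2 * M / \<omega> 1) f x y" by (simp add: osc_le_def)
      then show ?thesis by (rule osc_le_mono) (use A that in \<open>auto simp: A_def\<close>)
    qed
    moreover have "0 < A" using A by (simp add: A_def add_pos_nonneg)
    ultimately show ?thesis unfolding C0_dot_iff by blast
  qed
  have "f \<in> VC_small \<omega>" using Lip_subset_VC_small f C0 by blast
  moreover have "f \<in> VC_large \<omega>"
    unfolding VC_large_iff
  proof (intro conjI allI impI C0)
    fix e :: real assume e: "0 < e"
    obtain T where T: "0 < T" "\<And>t. T \<le> t \<Longrightarrow> 2 * M / e \<le> \<omega> t" using \<omega>_large[of 0 "2 * M / e"] by blast
    have "osc_le e f x y" if "T \<le> norm (x - y)" for x y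
      using diff[of x y] T(2)[OF that] e by (simp add: osc_le_def divide_le_eq mult.commute)
    with T(1) show "\<exists>T>0. \<forall>x y. T \<le> norm (x - y) \<longrightarrow> osc_le e f x y" by blast
  qed
  moreover have "f \<in> VC_far \<omega>"
    unfolding VC_far_iff
  proof (intro conjI allI impI C0)
    fix e :: real assume e: "0 < e"
    have "osc_le e f x y" if "x \<noteq> y" "max R 1 < norm x" "max R 1 < norm y" for x y
      using R[of x] R[of y] that e \<omega>_pos[of "norm (x - y)"] by (simp add: osc_le_def)
    then show "\<exists>R>0. \<forall>x y. x \<noteq> y \<longrightarrow> R < norm x \<longrightarrow> R < norm y \<longrightarrow> osc_le e f x y"
      by (intro exI[of _ "max R 1"]) auto
  qed
  ultimately show ?thesis by (simp add: VC_def)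
qed

end

text \<open>A Hoelder derivative is bounded on a ball, which makes \<open>f\<close> Lipschitz there.
  Using radius \<open>R + 1\<close> leaves a collar of width \<open>1\<close> around the support for
  pairs with a point outside.\<close>

lemma C1_bs_Lip_bounded:
  fixes f :: "'a::real_normed_vector \<Rightarrow> real"
  assumes "0 < \<alpha>" "f \<in> C1_bs \<alpha>"
  shows "f \<in> Lip \<and> (\<exists>M. \<forall>x. \<bar>f x\<bar> \<le> M) \<and> (\<exists>R. \<forall>x. x \<notin> ball 0 R \<longrightarrow> f x = 0)"
proof -
  have f: "f \<in> C1 \<alpha>" "\<exists>R. \<forall>x. x \<notin> ball 0 R \<longrightarrow> f x = 0"
    using assms(2) by (simp_all add: C1_bs_def)
  from f(1) obtain D :: "'a \<Rightarrow> 'a \<Rightarrow>\<^sub>L real" and K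
    where D: "\<forall>x. (f has_derivative blinfun_apply (D x)) (at x)"
      and K: "\<forall>x y. x \<noteq> y \<longrightarrow> norm (D x - D y) / norm (x - y) powr \<alpha> \<le> K"
    unfolding C1_def mem_Collect_eq by (elim exE conjE)
  from f(2) obtain R\<^sub>0 where R\<^sub>0: "\<And>x. x \<notin> ball 0 R\<^sub>0 \<Longrightarrow> f x = 0" by blast
  define R where "R = \<bar>R\<^sub>0\<bar>"
  have R: "f x = 0" if "x \<notin> ball 0 R" for x using that by (intro R\<^sub>0) (simp add: R_def)
  define L where "L = norm (D 0) + \<bar>K\<bar> * (R + 1) powr \<alpha>"
  have L0: "0 \<le> L" by (simp add: L_def)
  have lip: "L-lipschitz_on (ball 0 (R + 1)) f"
  proof (rule bounded_derivative_imp_lipschitz)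
    show "(f has_derivative blinfun_apply (D x)) (at x within ball 0 (R + 1))" for x
      using D[rule_format] by (rule has_derivative_at_withinI)
    show "onorm (blinfun_apply (D x)) \<le> L" if x: "x \<in> ball 0 (R + 1)" for x
    proof -
      have "norm (D x - D 0) \<le> \<bar>K\<bar> * (R + 1) powr \<alpha>"
      proof (cases "x = 0")
        case False
        have "norm (D x - D 0) \<le> K * norm x powr \<alpha>"
          using K[rule_format, of x 0] False by (simp add: divide_le_eq)
        also have "\<dots> \<le> \<bar>K\<bar> * (R + 1) powr \<alpha>"
          using x assms(1) by (intro mult_mono powr_mono2) auto
        finally show ?thesis .
      qed simp
      then show ?thesis
        using norm_triangle_ineq[of "D x - D 0" "D 0"] by (simp add: L_def norm_blinfun.rep_eq)
    qed
  qed (use L0 in auto)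
  define M where "M = \<bar>f 0\<bar> + L * (R + 1)"
  have M: "\<bar>f x\<bar> \<le> M" for x
  proof (cases "x \<in> ball 0 (R + 1)")
    case True
    have "\<bar>f x - f 0\<bar> \<le> L * norm x"
      using lipschitz_onD[OF lip True, of 0] by (simp add: dist_norm R_def)
    also have "\<dots> \<le> L * (R + 1)" using True L0 by (intro mult_left_mono) auto
    finally show ?thesis by (simp add: M_def)
  next
    case False
    then have "f x = 0" by (intro R) simp
    then show ?thesis using L0 by (simp add: M_def R_def)
  qed
  have M0: "0 \<le> M" using M[of 0] by linarith
  \<comment> \<open>A pair that crosses the collar has distance at least \<open>1\<close>, so the
    bound \<open>M\<close> on the values is itself a Lipschitz estimate.\<close>
  have half: "\<bar>f x - f y\<bar> \<le> (L + M) * norm (x - y)" if y: "y \<notin> ball 0 (R + 1)" for x y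
  proof (cases "x \<in> ball 0 R")
    case True
    have "1 \<le> norm (x - y)" using True y norm_triangle_ineq2[of y x] by (simp add: norm_minus_commute)
    then have "M * 1 \<le> (L + M) * norm (x - y)" using L0 M0 by (intro mult_mono) auto
    moreover have "f y = 0" using y by (intro R) simp
    ultimately show ?thesis using M[of x] by simp
  next
    case False
    have "f x = 0" "f y = 0" using False y by (auto intro: R)
    then show ?thesis using L0 M0 by simp
  qed
  have "(L + M)-lipschitz_on UNIV f"
  proof (rule lipschitz_onI)
    fix x y :: 'a
    consider "x \<in> ball 0 (R + 1)" "y \<in> ball 0 (R + 1)" | "y \<notin> ball 0 (R + 1)" | "x \<notin> ball 0 (R + 1)" by blast
    then show "dist (f x) (f y) \<le> (L + M) * dist x y"
    proof cases
      case 1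
      have "dist (f x) (f y) \<le> L * dist x y" by (rule lipschitz_onD[OF lip 1])
      also have "\<dots> \<le> (L + M) * dist x y" using M0 by (intro mult_right_mono) auto
      finally show ?thesis .
    next
      case 2
      then show ?thesis using half[of y x] by (simp add: dist_norm)
    next
      case 3
      then show ?thesis using half[of x y] by (simp add: dist_norm norm_minus_commute abs_minus_commute)
    qed
  qed (use L0 M0 in simp)
  then have "f \<in> Lip" by (auto simp: Lip_def)
  then show ?thesis using M R by blast
qed

section \<open>Regularization\<close>

text \<open>Of the equivalence constants, the lower one gives the growth of \<open>P\<close>, and
  the upper one replaces \<open>N h\<close> by \<open>norm h\<close> in the smoothness
  inequality.\<close>

lemma smooth_renorming_imp_smooth_gauge:
  assumes "smooth_renorming TYPE('a::real_normed_vector) \<alpha>" "0 < \<alpha>"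
  shows "\<exists>(P :: 'a \<Rightarrow> real) a C. smooth_gauge P (1 + \<alpha>) a C"
proof -
  obtain N :: "'a \<Rightarrow> real" and C where C: "0 < C" and N: "equivalent_norm N"
    and diff: "\<forall>x h. N (x + h) powr (1 + \<alpha>) + N (x - h) powr (1 + \<alpha>) - 2 * N x powr (1 + \<alpha>)
                \<le> C * N h powr (1 + \<alpha>)"
    using assms(1) unfolding smooth_renorming_def by (elim exE conjE)
  from N obtain a b where ab: "0 < a" "0 < b" and le: "\<forall>x. a * norm x \<le> N x \<and> N x \<le> b * norm x"
    unfolding equivalent_norm_def by (elim exE conjE)
  have N0: "0 \<le> N x" for x
  proof -
    have "0 \<le> a * norm x" using ab(1) by simp
    with le[rule_format, of x] show ?thesis by linarith
  qed
  have "smooth_gauge (\<lambda>x. N x powr (1 + \<alpha>)) (1 + \<alpha>) (a powr (1 + \<alpha>)) (C * b powr (1 + \<alpha>))"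
  proof
    show "1 < 1 + \<alpha>" "0 < a powr (1 + \<alpha>)" "0 < C * b powr (1 + \<alpha>)" using assms(2) ab C by auto
    show "N 0 powr (1 + \<alpha>) = 0" using le[rule_format, of 0] N0[of 0] by simp
    fix x h :: 'a
    have "a powr (1 + \<alpha>) * norm x powr (1 + \<alpha>) = (a * norm x) powr (1 + \<alpha>)"
      using ab(1) by (intro powr_mult[symmetric])
    also have "\<dots> \<le> N x powr (1 + \<alpha>)" using le ab(1) assms(2) by (intro powr_mono2) auto
    finally show "a powr (1 + \<alpha>) * norm x powr (1 + \<alpha>) \<le> N x powr (1 + \<alpha>)" .
    have "N h powr (1 + \<alpha>) \<le> (b * norm h) powr (1 + \<alpha>)"
      using le N0 assms(2) by (intro powr_mono2) auto
    also have "\<dots> = b powr (1 + \<alpha>) * norm h powr (1 + \<alpha>)"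
      using ab(2) by (intro powr_mult)
    finally have "C * N h powr (1 + \<alpha>) \<le> C * b powr (1 + \<alpha>) * norm h powr (1 + \<alpha>)"
      using C by simp
    then show "N (x + h) powr (1 + \<alpha>) + N (x - h) powr (1 + \<alpha>) - 2 * N x powr (1 + \<alpha>)
        \<le> C * b powr (1 + \<alpha>) * norm h powr (1 + \<alpha>)"
      by (rule order_trans[OF diff[rule_format]])
  qed
  then show ?thesis by blast
qed

context modulus
begin

text \<open>Increments over distances up to \<open>s\<close> are at most \<open>\<eta>\<close>, and
  chaining makes growth at most linear. Where \<open>norm h / s\<close> exceeds \<open>1\<close> it
  is dominated by its \<open>p\<close>-th power.\<close>

lemma VC_small_coarse:
  fixes f P :: "'a::real_normed_vector \<Rightarrow> real"
  assumes "smooth_gauge P p a C" and f: "f \<in> VC_small \<omega>"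
  shows "smooth_gauge.coarse p f"
proof -
  interpret smooth_gauge P p a C by (rule assms(1))
  show ?thesis
    unfolding coarse_def
  proof (intro allI impI)
    fix \<eta> :: real assume \<eta>: "0 < \<eta>"
    have \<omega>1: "0 < \<omega> 1" by (simp add: \<omega>_pos)
    obtain d where d: "0 < d" "\<forall>x y. x \<noteq> y \<longrightarrow> norm (x - y) < d \<longrightarrow> osc_le (\<eta> / \<omega> 1) f x y"
      using f divide_pos_pos[OF \<eta> \<omega>1] unfolding VC_small_iff by blast
    \<comment> \<open>Below \<open>d\<close>, so that the oscillation bound holds also at distance
      \<open>s\<close> itself, and below \<open>1\<close>, so that \<open>\<omega>\<close> is at
      most \<open>\<omega> 1\<close> there.\<close>
    define s where "s = min d 1 / 2"
    have s: "0 < s" "s < d" "s < 1" using d(1) by (auto simp: s_def)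
    have near: "\<bar>f x - f y\<bar> \<le> \<eta>" if "norm (x - y) \<le> s" for x y
    proof (cases "x = y")
      case False
      then have "\<bar>f x - f y\<bar> \<le> \<eta> / \<omega> 1 * \<omega> (norm (x - y))"
        using d(2) that s(2) by (simp add: osc_le_def)
      also have "\<dots> \<le> \<eta> / \<omega> 1 * \<omega> 1"
        using False that s(3) \<eta> \<omega>1 by (intro mult_left_mono \<omega>_mono) auto
      finally show ?thesis using \<omega>1 by simp
    qed (use \<eta> in simp)
    have "\<bar>f (x + h) - f x\<bar> \<le> \<eta> + \<eta> / s powr p * norm h powr p" for x h
    proof -
      have "\<bar>f (x + h) - f x\<bar> \<le> (norm (x + h - x) / s + 1) * \<eta>"
        by (rule chain_bound[OF convex_UNIV UNIV_I UNIV_I s(1)]) (rule near)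
      then have chain: "\<bar>f (x + h) - f x\<bar> \<le> \<eta> + \<eta> * (norm h / s)"
        by (simp add: algebra_simps)
      show ?thesis
      proof (cases "norm h \<le> s")
        case True
        have "\<bar>f (x + h) - f x\<bar> \<le> \<eta>" using near[of "x + h" x] True by simp
        moreover have "0 \<le> \<eta> / s powr p * norm h powr p" using \<eta> by simp
        ultimately show ?thesis by linarith
      next
        case False
        have "(norm h / s) powr 1 \<le> (norm h / s) powr p"
          using False s(1) p_gt_1 by (intro powr_mono) auto
        then have "norm h / s \<le> norm h powr p / s powr p"
          using s(1) by (simp add: powr_divide)
        then have "\<eta> * (norm h / s) \<le> \<eta> * (norm h powr p / s powr p)"
          using \<eta> by (intro mult_left_mono) auto
        with chain show ?thesis by simp
      qed
    qed
    then show "\<exists>K. \<forall>x h. \<bar>f (x + h) - f x\<bar> \<le> \<eta> + K * norm h powr p" by blast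
  qed
qed

text \<open>At distances below \<open>d\<close> both \<open>f\<close> and \<open>g\<close> oscillate
  little, as \<open>g\<close> inherits the increments of \<open>f\<close>; at distances from
  \<open>d\<close> on, uniform closeness suffices.\<close>

lemma VC_small_regularization:
  fixes f :: "'a::real_normed_vector \<Rightarrow> real"
  assumes \<alpha>: "0 < \<alpha>" and gauge: "smooth_gauge (P :: 'a \<Rightarrow> real) (1 + \<alpha>) a C"
    and f: "f \<in> VC_small \<omega>" and e: "0 < e"
  shows "\<exists>g. g \<in> C1 \<alpha> \<inter> Lip \<inter> C0_dot \<omega> \<and>
    (\<forall>x y. x \<noteq> y \<longrightarrow> osc_le e (\<lambda>x. g x - f x) x y) \<and>
    (\<forall>R. (\<forall>x. x \<notin> ball 0 R \<longrightarrow> f x = 0) \<longrightarrow> (\<exists>R'. \<forall>x. x \<notin> ball 0 R' \<longrightarrow> g x = 0))"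
proof -
  interpret smooth_gauge P "1 + \<alpha>" a C by (rule gauge)
  obtain d where d: "0 < d" "\<forall>x y. x \<noteq> y \<longrightarrow> norm (x - y) < d \<longrightarrow> osc_le (e / 2) f x y"
    using f half_gt_zero[OF e] unfolding VC_small_iff by blast
  have "f \<in> C0_dot \<omega>" using f by (simp add: VC_small_iff)
  then obtain A where A: "0 < A" "\<forall>x y. x \<noteq> y \<longrightarrow> osc_le A f x y"
    unfolding C0_dot_iff by blast
  have \<omega>d: "0 < \<omega> d" using d(1) by (rule \<omega>_pos)
  \<comment> \<open>Two errors of this size add up to \<open>e * \<omega> d\<close>, the oscillation
    allowed at distance \<open>d\<close>.\<close>
  have \<eta>: "0 < e * \<omega> d / 2" using e \<omega>d by simp
  obtain g B where reg: "regularizes (e * \<omega> d / 2) f g"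
    and B: "\<forall>x h. \<bar>g (x + h) + g (x - h) - 2 * g x\<bar> \<le> B * norm h powr (1 + \<alpha>)"
    using two_sided_regularization[OF VC_small_coarse[OF gauge f] \<eta>] by blast
  have near: "\<bar>g x - f x\<bar> \<le> e * \<omega> d / 2" for x
    using reg unfolding regularizes_def by blast
  have transl: "\<bar>g (x + h) - g x\<bar> \<le> b" if "\<And>z. \<bar>f (z + h) - f z\<bar> \<le> b" for x h b
    using reg that unfolding regularizes_def by blast
  \<comment> \<open>The allowed increment depends only on the shift \<open>x - y\<close>, so a bound
    on \<open>f\<close> at all pairs with this difference carries over to \<open>g\<close>.\<close>
  have osc_transl: "osc_le c g x y" if c: "\<And>u v. u - v = x - y \<Longrightarrow> osc_le c f u v" for c x y
  proof -
    have "\<bar>g (y + (x - y)) - g y\<bar> \<le> c * \<omega> (norm (x - y))"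
    proof (rule transl)
      fix z
      have "z + (x - y) - z = x - y" by simp
      from c[OF this] show "\<bar>f (z + (x - y)) - f z\<bar> \<le> c * \<omega> (norm (x - y))"
        by (simp add: osc_le_def)
    qed
    then show ?thesis by (simp add: osc_le_def)
  qed
  have "osc_le A g x y" if "x \<noteq> y" for x y
  proof (rule osc_transl)
    fix u v assume "u - v = x - y"
    with that have "u \<noteq> v" by auto
    with A(2) show "osc_le A f u v" by blast
  qed
  with A(1) have C0: "g \<in> C0_dot \<omega>" unfolding C0_dot_iff by blast
  \<comment> \<open>\<open>A * \<omega> 1\<close> bounds the increments of \<open>f\<close> over
    shifts of norm at most \<open>1\<close>, by monotonicity, and hence those of
    \<open>g\<close>.\<close>
  interpret small_second_differences g \<alpha> B "A * \<omega> 1"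
  proof
    show "0 < \<alpha>" by (rule \<alpha>)
    show "\<bar>g (x + h) + g (x - h) - 2 * g x\<bar> \<le> B * norm h powr (1 + \<alpha>)" for x h using B by blast
    show "\<bar>g (x + h) - g x\<bar> \<le> A * \<omega> 1" if h: "norm h \<le> 1" for x h
    proof (rule transl)
      fix z
      show "\<bar>f (z + h) - f z\<bar> \<le> A * \<omega> 1"
      proof (cases "h = 0")
        case True
        then show ?thesis using A(1) \<omega>_pos[of 1] by simp
      next
        case False
        have "z + h \<noteq> z" using False by simp
        with A(2) have "osc_le A f (z + h) z" by blast
        then have "\<bar>f (z + h) - f z\<bar> \<le> A * \<omega> (norm h)" by (simp add: osc_le_def)
        also have "\<dots> \<le> A * \<omega> 1" using A(1) h False by (intro mult_left_mono \<omega>_mono) auto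
        finally show ?thesis .
      qed
    qed
  qed
  have "osc_le e (\<lambda>x. g x - f x) x y" if xy: "x \<noteq> y" for x y
  proof (cases "norm (x - y) < d")
    case True
    have f_osc: "osc_le (e / 2) f u v" if "u - v = x - y" for u v
    proof -
      have "u \<noteq> v" "norm (u - v) < d" using that True xy by auto
      with d(2) show ?thesis by blast
    qed
    have "osc_le (e / 2) g x y" by (rule osc_transl) (rule f_osc)
    with f_osc[OF refl] show ?thesis unfolding osc_le_def by argo
  next
    case False
    have "\<bar>g x - f x - (g y - f y)\<bar> \<le> e * \<omega> d" using near[of x] near[of y] by argo
    also have "\<dots> \<le> e * \<omega> (norm (x - y))" using e d(1) False by (intro mult_left_mono \<omega>_mono) auto
    finally show ?thesis by (simp add: osc_le_def)
  qed
  moreover have "\<forall>R. (\<forall>x. x \<notin> ball 0 R \<longrightarrow> f x = 0) \<longrightarrow> (\<exists>R'. \<forall>x. x \<notin> ball 0 R' \<longrightarrow> g x = 0)"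
    using reg unfolding regularizes_def by blast
  ultimately show ?thesis using in_C1 in_Lip C0 by blast
qed

text \<open>Along rays outside a large ball \<open>f\<close> has arbitrarily small increments at scale 1.\<close>

lemma VC_far_sublinear:
  fixes f :: "'a::real_normed_vector \<Rightarrow> real"
  assumes f: "f \<in> VC_far \<omega>" and \<kappa>: "0 < \<kappa>"
  shows "\<exists>R\<^sub>0>0. \<forall>R\<ge>R\<^sub>0. \<forall>x. norm x \<le> 2 * R \<longrightarrow> \<bar>f x - f 0\<bar> \<le> \<kappa> * R"
proof -
  have \<omega>1: "0 < \<omega> 1" by (simp add: \<omega>_pos)
  \<comment> \<open>Chosen so that a step of length at most \<open>1\<close> outside the ball costs
    at most \<open>\<kappa> / 4\<close>.\<close>
  define e where "e = \<kappa> / (4 * \<omega> 1)"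
  have e: "0 < e" using \<kappa> \<omega>1 by (simp add: e_def)
  obtain R\<^sub>1 where R\<^sub>1: "0 < R\<^sub>1"
    "\<forall>x y. x \<noteq> y \<longrightarrow> R\<^sub>1 < norm x \<longrightarrow> R\<^sub>1 < norm y \<longrightarrow> osc_le e f x y"
    using f e unfolding VC_far_iff by blast
  have "f \<in> C0_dot \<omega>" using f by (simp add: VC_far_iff)
  then obtain A where A: "0 < A" "\<forall>x y. x \<noteq> y \<longrightarrow> osc_le A f x y"
    unfolding C0_dot_iff by blast
  define r where "r = R\<^sub>1 + 1"
  define K where "K = A * \<omega> r"
  have r: "0 < r" using R\<^sub>1(1) by (simp add: r_def)
  have K: "0 \<le> K" using A(1) \<omega>_pos[OF r] by (simp add: K_def)
  have inner: "\<bar>f x - f 0\<bar> \<le> K" if "norm x \<le> r" for x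
  proof (cases "x = 0")
    case False
    then have "osc_le A f x 0" using A(2) by blast
    then have "\<bar>f x - f 0\<bar> \<le> A * \<omega> (norm x)" by (simp add: osc_le_def)
    also have "\<dots> \<le> K" unfolding K_def using A(1) that False by (intro mult_left_mono \<omega>_mono) auto
    finally show ?thesis .
  qed (use K in simp)
  have outer: "\<bar>f x - f 0\<bar> \<le> K + (norm x + 1) * (\<kappa> / 4)" if "r < norm x" for x
  proof -
    define z where "z = (r / norm x) *\<^sub>R x"
    \<comment> \<open>The exterior of a ball is not convex, but the part of the ray through
      \<open>x\<close> from \<open>z\<close> outwards is, and it stays outside radius
      \<open>R\<^sub>1\<close>.\<close>
    define S where "S = (\<lambda>s. s *\<^sub>R x) ` {r / norm x..}"
    have x: "x \<noteq> 0" using that r by auto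
    have nz: "norm z = r" using x r by (simp add: z_def)
    have "convex S"
      unfolding S_def by (intro convex_linear_image bounded_linear.linear bounded_linear_scaleR_left convex_real_interval)
    have "x \<in> S"
      unfolding S_def using that x by (intro image_eqI[of _ _ 1]) auto
    have "z \<in> S" unfolding S_def z_def by (rule imageI) simp
    have S: "R\<^sub>1 < norm u" if u: "u \<in> S" for u
    proof -
      obtain s where s: "u = s *\<^sub>R x" "r / norm x \<le> s" using u by (auto simp: S_def)
      have "r \<le> s * norm x" using s(2) x by (simp add: divide_le_eq)
      also have "\<dots> \<le> norm u" by (simp add: s(1) mult_right_mono)
      finally show ?thesis by (simp add: r_def)
    qed
    have "\<bar>f x - f z\<bar> \<le> (norm (x - z) / 1 + 1) * (\<kappa> / 4)"
    proof (rule chain_bound[OF \<open>convex S\<close> \<open>x \<in> S\<close> \<open>z \<in> S\<close> zero_less_one])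
      fix u v assume uv: "u \<in> S" "v \<in> S" "norm (u - v) \<le> 1"
      show "\<bar>f u - f v\<bar> \<le> \<kappa> / 4"
      proof (cases "u = v")
        case False
        then have "osc_le e f u v" using R\<^sub>1(2) S uv(1,2) by blast
        then have "\<bar>f u - f v\<bar> \<le> e * \<omega> (norm (u - v))" by (simp add: osc_le_def)
        also have "\<dots> \<le> e * \<omega> 1" using e False uv(3) by (intro mult_left_mono \<omega>_mono) auto
        also have "\<dots> = \<kappa> / 4" using \<omega>1 by (simp add: e_def)
        finally show ?thesis .
      qed (use \<kappa> in simp)
    qed
    moreover have "norm (x - z) \<le> norm x"
    proof -
      have "x - z = (1 - r / norm x) *\<^sub>R x" by (simp add: z_def scaleR_diff_left)
      then have "norm (x - z) = \<bar>1 - r / norm x\<bar> * norm x" by simp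
      also have "\<dots> \<le> 1 * norm x" using that r x by (intro mult_right_mono) auto
      finally show ?thesis by simp
    qed
    then have "(norm (x - z) / 1 + 1) * (\<kappa> / 4) \<le> (norm x + 1) * (\<kappa> / 4)"
      using \<kappa> by (intro mult_right_mono) auto
    moreover have "\<bar>f z - f 0\<bar> \<le> K" using inner nz by simp
    ultimately show ?thesis by linarith
  qed
  show ?thesis
  \<comment> \<open>This threshold gives \<open>4 * K + \<kappa> \<le> \<kappa> * R\<close>, so that
    the constant terms take at most a quarter of \<open>\<kappa> * R\<close>, next to the half taken
    by the linear term.\<close>
  proof (intro exI[of _ "4 * K / \<kappa> + 1"] conjI allI impI)
    show "0 < 4 * K / \<kappa> + 1" using K \<kappa> by (simp add: add_nonneg_pos)
    fix R and x :: 'a assume R: "4 * K / \<kappa> + 1 \<le> R" and x: "norm x \<le> 2 * R"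
    have R1: "4 * K + \<kappa> \<le> \<kappa> * R"
    proof -
      have "\<kappa> * (4 * K / \<kappa> + 1) \<le> \<kappa> * R" using R \<kappa> by (intro mult_left_mono) auto
      then show ?thesis using \<kappa> by (simp add: distrib_left)
    qed
    show "\<bar>f x - f 0\<bar> \<le> \<kappa> * R"
    proof (cases "norm x \<le> r")
      case True
      with inner[OF this] R1 K \<kappa> show ?thesis by linarith
    next
      case False
      then have "\<bar>f x - f 0\<bar> \<le> K + (norm x + 1) * (\<kappa> / 4)" by (intro outer) simp
      also have "\<dots> \<le> K + (2 * R + 1) * (\<kappa> / 4)" using x \<kappa> by (intro add_left_mono mult_right_mono) auto
      also have "\<dots> = K + \<kappa> / 4 + \<kappa> * R / 2" by (simp add: field_simps)
      also have "\<dots> \<le> \<kappa> * R" using R1 K \<kappa> by argo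
      finally show ?thesis .
    qed
  qed
qed

end

section \<open>Truncation\<close>

context modulus
begin

text \<open>Extends the vanishing at large distances to all steps of length up to \<open>t\<close>,
  as needed for chaining: increments over short steps are bounded, and the growth of
  \<open>\<omega>\<close> absorbs them.\<close>

lemma VC_large_steps:
  fixes f :: "'a::real_normed_vector \<Rightarrow> real"
  assumes f: "f \<in> VC_large \<omega>" and e: "0 < e"
  shows "\<exists>T>0. \<forall>t\<ge>T. \<forall>x y. norm (x - y) \<le> t \<longrightarrow> \<bar>f x - f y\<bar> \<le> e * \<omega> t"
proof -
  have "f \<in> C0_dot \<omega>" using f by (simp add: VC_large_iff)
  then obtain A where A: "0 < A" "\<forall>x y. x \<noteq> y \<longrightarrow> osc_le A f x y"
    unfolding C0_dot_iff by blast
  obtain T where T: "0 < T" "\<forall>x y. T \<le> norm (x - y) \<longrightarrow> osc_le e f x y"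
    using f e unfolding VC_large_iff by blast
  obtain T' where T': "0 < T'" "T \<le> T'" "\<forall>t\<ge>T'. A * \<omega> T / e \<le> \<omega> t"
    using \<omega>_large[of T "A * \<omega> T / e"] by blast
  have "\<bar>f x - f y\<bar> \<le> e * \<omega> t" if t: "T' \<le> t" and le: "norm (x - y) \<le> t" for t x y
  proof -
    have t0: "0 < t" using t T'(1) by simp
    consider "x = y" | "x \<noteq> y" "norm (x - y) \<le> T" | "T \<le> norm (x - y)" by linarith
    then show ?thesis
    proof cases
      case 1
      then show ?thesis using e \<omega>_pos[OF t0] by simp
    next
      case 2
      have "\<bar>f x - f y\<bar> \<le> A * \<omega> (norm (x - y))" using A(2) 2(1) by (simp add: osc_le_def)
      also have "\<dots> \<le> A * \<omega> T" using A(1) 2 by (intro mult_left_mono \<omega>_mono) auto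
      also have "\<dots> \<le> e * \<omega> t" using T'(3) t e by (simp add: divide_le_eq mult.commute)
      finally show ?thesis .
    next
      case 3
      have "\<bar>f x - f y\<bar> \<le> e * \<omega> (norm (x - y))" using T(2) 3 by (simp add: osc_le_def)
      also have "\<dots> \<le> e * \<omega> t" using e 3 T(1) le by (intro mult_left_mono \<omega>_mono) auto
      finally show ?thesis .
    qed
  qed
  with T'(1) show ?thesis by blast
qed

end

section \<open>Cutoff functions\<close>

definition cutoff :: "real \<Rightarrow> 'a::real_normed_vector \<Rightarrow> real" where
  "cutoff R x = max 0 (min 1 (2 - norm x / R))"

lemma cutoff_range: "0 \<le> cutoff R x" "cutoff R x \<le> 1"
  by (auto simp: cutoff_def)

lemma cutoff_eq_1: "0 < R \<Longrightarrow> norm x \<le> R \<Longrightarrow> cutoff R x = 1"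
  by (simp add: cutoff_def divide_le_eq)

lemma cutoff_eq_0: "0 < R \<Longrightarrow> 2 * R \<le> norm x \<Longrightarrow> cutoff R x = 0"
  by (simp add: cutoff_def le_divide_eq)

lemma cutoff_diff_le_1: "\<bar>cutoff R x - cutoff R y\<bar> \<le> 1"
  using cutoff_range[of R x] cutoff_range[of R y] by linarith

lemma cutoff_lipschitz:
  assumes "0 < R"
  shows "\<bar>cutoff R x - cutoff R y\<bar> \<le> norm (x - y) / R"
proof -
  have "\<bar>cutoff R x - cutoff R y\<bar> \<le> \<bar>norm x / R - norm y / R\<bar>"
    unfolding cutoff_def by linarith
  also have "\<dots> = \<bar>norm x - norm y\<bar> / R" using assms by (simp flip: diff_divide_distrib)
  also have "\<dots> \<le> norm (x - y) / R" using assms norm_triangle_ineq3[of x y] by (intro divide_right_mono) auto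
  finally show ?thesis .
qed

context modulus
begin

text \<open>The cutoff multiplies \<open>f - f 0\<close>, since the seminorm ignores constants. The
  error splits into an increment of \<open>f\<close>, weighted by \<open>1 - cutoff R y\<close> and
  so felt only where \<open>norm y > R\<close>, and an increment of the cutoff, weighted by the size
  of \<open>f - f 0\<close>.\<close>

lemma VC_cutoff:
  fixes f :: "'a::real_normed_vector \<Rightarrow> real"
  assumes f: "f \<in> VC \<omega>" and e: "0 < e"
  shows "\<exists>g\<in>VC_small \<omega>. (\<exists>R. \<forall>x. x \<notin> ball 0 R \<longrightarrow> g x = 0) \<and>
    (\<forall>x y. x \<noteq> y \<longrightarrow> osc_le e (\<lambda>x. g x - f x) x y)"
proof -
  have f_small: "f \<in> VC_small \<omega>" and f_large: "f \<in> VC_large \<omega>" and f_far: "f \<in> VC_far \<omega>"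
    and f_C0: "f \<in> C0_dot \<omega>"
    using f by (auto simp: VC_def VC_far_def)
  \<comment> \<open>The increment of \<open>f\<close> will take one quarter, the increment of the
    cutoff three.\<close>
  define e' where "e' = e / 4"
  have e': "0 < e'" using e by (simp add: e'_def)
  obtain T where T: "0 < T" "\<forall>t\<ge>T. \<forall>x y. norm (x - y) \<le> t \<longrightarrow> \<bar>f x - f y\<bar> \<le> e' * \<omega> t"
    using VC_large_steps[OF f_large e'] by blast
  obtain R\<^sub>0 where R\<^sub>0: "0 < R\<^sub>0"
    "\<forall>x y. x \<noteq> y \<longrightarrow> R\<^sub>0 < norm x \<longrightarrow> R\<^sub>0 < norm y \<longrightarrow> osc_le e' f x y"
    using f_far e' unfolding VC_far_iff by blast
  obtain c where c: "0 < c" "\<forall>t. 0 < t \<longrightarrow> t \<le> T \<longrightarrow> t \<le> c * \<omega> t"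
    using id_le_bounded[of T] by blast
  \<comment> \<open>Makes \<open>\<kappa> * t \<le> e' * \<omega> t\<close> for \<open>t\<close> up
    to \<open>T\<close>.\<close>
  define \<kappa> where "\<kappa> = e' / c"
  have \<kappa>: "0 < \<kappa>" using e' c(1) by (simp add: \<kappa>_def)
  obtain R\<^sub>1 where R\<^sub>1: "0 < R\<^sub>1" "\<forall>R\<ge>R\<^sub>1. \<forall>x. norm x \<le> 2 * R \<longrightarrow> \<bar>f x - f 0\<bar> \<le> \<kappa> * R"
    using VC_far_sublinear[OF f_far \<kappa>] by blast
  \<comment> \<open>The margin \<open>T\<close> ensures that a point within \<open>T\<close> of a
    point of norm above \<open>R\<close> has norm above \<open>R\<^sub>0\<close>.\<close>
  define R where "R = max R\<^sub>1 (R\<^sub>0 + T + 1)"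
  have R: "0 < R" "R\<^sub>0 + T < R" using R\<^sub>0(1) T(1) by (auto simp: R_def)
  have fR: "\<bar>f x - f 0\<bar> \<le> \<kappa> * R" if "norm x \<le> 2 * R" for x
    using R\<^sub>1(2) that by (simp add: R_def)
  define g where "g = (\<lambda>x. (f x - f 0) * cutoff R x)"
  have outside: "cutoff R x = cutoff R y" if "2 * R < norm x" "norm x \<le> norm y" for x y :: 'a
    using that R(1) by (simp add: cutoff_eq_0)
  \<comment> \<open>The ordering of the norms puts the factor \<open>f - f 0\<close> at the point
    nearer the origin: it is at most \<open>\<kappa> * R\<close> within \<open>2 * R\<close>, and
    beyond that both cutoffs vanish.\<close>
  have slope: "\<bar>(f x - f 0) * (cutoff R x - cutoff R y)\<bar> \<le> \<kappa> * norm (x - y)" if "norm x \<le> norm y" for x y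
  proof (cases "norm x \<le> 2 * R")
    case True
    have "\<bar>(f x - f 0) * (cutoff R x - cutoff R y)\<bar> \<le> (\<kappa> * R) * (norm (x - y) / R)"
      unfolding abs_mult using fR[OF True] cutoff_lipschitz[OF R(1)] \<kappa> R(1) by (intro mult_mono) auto
    then show ?thesis using R(1) by simp
  next
    case False
    then show ?thesis using outside[of x y] that \<kappa> by simp
  qed
  have diff_g: "\<bar>(g x - f x) - (g y - f y)\<bar> \<le> e * \<omega> (norm (x - y))" if xy: "x \<noteq> y" "norm x \<le> norm y" for x y
  proof -
    define t where "t = norm (x - y)"
    have t: "0 < t" using xy(1) by (simp add: t_def)
    have \<omega>t: "0 < \<omega> t" using t by (rule \<omega>_pos)
    have 1: "\<bar>(f x - f y) * (1 - cutoff R y)\<bar> \<le> e' * \<omega> t"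
    proof (cases "norm y \<le> R")
      case True
      then show ?thesis using R(1) e' \<omega>t by (simp add: cutoff_eq_1)
    next
      case False
      have "\<bar>f x - f y\<bar> \<le> e' * \<omega> t"
      proof (cases "T \<le> t")
        case True
        then show ?thesis using T(2) by (simp add: t_def)
      next
        case False2: False
        have "R\<^sub>0 < norm y" using False R(2) T(1) by simp
        moreover have "norm y - norm x \<le> t" using norm_triangle_ineq2[of y x] by (simp add: t_def norm_minus_commute)
        then have "R\<^sub>0 < norm x" using False R(2) False2 by simp
        ultimately have "osc_le e' f x y" using R\<^sub>0(2) xy(1) by blast
        then show ?thesis by (simp add: osc_le_def t_def)
      qed
      then have "\<bar>(f x - f y) * (1 - cutoff R y)\<bar> \<le> (e' * \<omega> t) * 1"
        unfolding abs_mult using cutoff_range[of R y] e' \<omega>t by (intro mult_mono) auto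
      then show ?thesis by simp
    qed
    have 2: "\<bar>(f x - f 0) * (cutoff R x - cutoff R y)\<bar> \<le> 3 * (e' * \<omega> t)"
    proof (cases "t \<le> T")
      case True
      have "\<bar>(f x - f 0) * (cutoff R x - cutoff R y)\<bar> \<le> \<kappa> * t"
        using slope[OF xy(2)] by (simp add: t_def)
      also have "\<dots> \<le> \<kappa> * (c * \<omega> t)" using c(2) t True \<kappa> by (intro mult_left_mono) auto
      also have "\<dots> = e' * \<omega> t" using c(1) by (simp add: \<kappa>_def)
      also have "\<dots> \<le> 3 * (e' * \<omega> t)" using mult_pos_pos[OF e' \<omega>t] by linarith
      finally show ?thesis .
    next
      case False
      show ?thesis
      proof (cases "norm x \<le> 2 * R")
        case True
        \<comment> \<open>For \<open>t\<close> above \<open>T\<close>, chaining from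
          \<open>x\<close> to \<open>0\<close> by steps of length \<open>t\<close> bounds
          \<open>f x - f 0\<close> in units of \<open>e' * \<omega> t\<close>. The number of steps
          times the cutoff increment is at most \<open>2 + 1\<close>.\<close>
        have "\<bar>f x - f 0\<bar> \<le> (norm (x - 0) / t + 1) * (e' * \<omega> t)"
          by (rule chain_bound[OF convex_UNIV UNIV_I UNIV_I t]) (use T(2) False in auto)
        also have "\<dots> \<le> (2 * R / t + 1) * (e' * \<omega> t)"
          using True t e' \<omega>t by (intro mult_right_mono add_right_mono divide_right_mono) auto
        finally have "\<bar>(f x - f 0) * (cutoff R x - cutoff R y)\<bar>
            \<le> (2 * R / t + 1) * (e' * \<omega> t) * min 1 (t / R)"
          unfolding abs_mult using cutoff_lipschitz[OF R(1), of x y] cutoff_diff_le_1[of R x y] t R(1) e' \<omega>t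
          by (intro mult_mono) (auto simp: t_def)
        also have "\<dots> = ((2 * R / t + 1) * min 1 (t / R)) * (e' * \<omega> t)" by (simp add: mult_ac)
        also have "\<dots> \<le> 3 * (e' * \<omega> t)"
        proof (intro mult_right_mono)
          have "2 * R / t * min 1 (t / R) \<le> 2 * R / t * (t / R)"
            using t R(1) by (intro mult_left_mono) auto
          also have "\<dots> = 2" using t R(1) by simp
          finally show "(2 * R / t + 1) * min 1 (t / R) \<le> 3" by (simp add: distrib_right)
        qed (use e' \<omega>t in simp)
        finally show ?thesis .
      next
        case False
        then show ?thesis using outside[of x y] xy(2) e' \<omega>t by simp
      qed
    qed
    have "(g x - f x) - (g y - f y) =
        (f x - f 0) * (cutoff R x - cutoff R y) - (f x - f y) * (1 - cutoff R y)"
      by (simp add: g_def algebra_simps)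
    with 1 2 have "\<bar>(g x - f x) - (g y - f y)\<bar> \<le> 4 * (e' * \<omega> t)" by linarith
    then show ?thesis by (simp add: e'_def t_def)
  qed
  have osc_g: "osc_le e (\<lambda>x. g x - f x) x y" if "x \<noteq> y" for x y
    using diff_g[of x y] diff_g[of y x] that
    by (cases "norm x \<le> norm y") (auto simp: osc_le_def norm_minus_commute abs_minus_commute)
  have "g \<in> VC_small \<omega>"
    unfolding VC_small_iff
  proof (intro conjI allI impI)
    obtain A where A: "0 < A" "\<forall>x y. x \<noteq> y \<longrightarrow> osc_le A f x y"
      using f_C0 unfolding C0_dot_iff by blast
    have "osc_le (A + e) g x y" if "x \<noteq> y" for x y
      using osc_le_add[of A f x y e g] A(2) osc_g that by blast
    moreover have "0 < A + e" using A(1) e by simp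
    ultimately show "g \<in> C0_dot \<omega>" unfolding C0_dot_iff by blast
    fix b :: real assume b: "0 < b"
    obtain d where d: "0 < d" "\<forall>x y. x \<noteq> y \<longrightarrow> norm (x - y) < d \<longrightarrow> osc_le (b / 2) f x y"
      using f_small half_gt_zero[OF b] unfolding VC_small_iff by blast
    \<comment> \<open>With this factor, the cutoff term of slope \<open>\<kappa>\<close> takes half
      of the budget \<open>b\<close> at small distances; the increment of \<open>f\<close> takes the
      other half.\<close>
    have "0 < b / (2 * \<kappa>)" using b \<kappa> by simp
    then obtain d' where d': "0 < d'" "\<forall>t. 0 < t \<longrightarrow> t < d' \<longrightarrow> t \<le> b / (2 * \<kappa>) * \<omega> t"
      using id_le_small by blast
    have le: "\<bar>g x - g y\<bar> \<le> b * \<omega> (norm (x - y))"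
      if xy: "x \<noteq> y" "norm (x - y) < min d d'" "norm x \<le> norm y" for x y
    proof -
      have "\<kappa> * norm (x - y) \<le> \<kappa> * (b / (2 * \<kappa>) * \<omega> (norm (x - y)))"
        using d'(2) xy \<kappa> by (intro mult_left_mono) auto
      then have "\<bar>(f x - f 0) * (cutoff R x - cutoff R y)\<bar> \<le> b / 2 * \<omega> (norm (x - y))"
        using slope[OF xy(3)] \<kappa> by simp
      moreover have "\<bar>(f x - f y) * cutoff R y\<bar> \<le> \<bar>f x - f y\<bar> * 1"
        unfolding abs_mult using cutoff_range[of R y] by (intro mult_left_mono) auto
      moreover have "osc_le (b / 2) f x y" using d(2) xy by simp
      then have "\<bar>f x - f y\<bar> \<le> b / 2 * \<omega> (norm (x - y))" by (simp add: osc_le_def)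
      moreover have "g x - g y = (f x - f 0) * (cutoff R x - cutoff R y) + (f x - f y) * cutoff R y"
        by (simp add: g_def algebra_simps)
      ultimately show ?thesis by argo
    qed
    have "osc_le b g x y" if "x \<noteq> y" "norm (x - y) < min d d'" for x y
      using le[of x y] le[of y x] that
      by (cases "norm x \<le> norm y") (auto simp: osc_le_def norm_minus_commute abs_minus_commute)
    then show "\<exists>d>0. \<forall>x y. x \<noteq> y \<longrightarrow> norm (x - y) < d \<longrightarrow> osc_le b g x y"
      using d(1) d'(1) by (intro exI[of _ "min d d'"]) auto
  qed
  moreover have "\<forall>x. x \<notin> ball 0 (2 * R) \<longrightarrow> g x = 0"
    using R(1) by (simp add: g_def cutoff_eq_0)
  ultimately show ?thesis using osc_g by blast
qed

section \<open>Identification of the two closures\<close>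

lemma C0_closure_C1_Lip:
  fixes P :: "'a::real_normed_vector \<Rightarrow> real"
  assumes "0 < \<alpha>" and gauge: "smooth_gauge P (1 + \<alpha>) a C"
  shows "C0_closure \<omega> (C1 \<alpha> \<inter> Lip \<inter> C0_dot \<omega>) = (VC_small \<omega> :: ('a \<Rightarrow> real) set)"
proof
  have "C1 \<alpha> \<inter> Lip \<inter> C0_dot \<omega> \<subseteq> (VC_small \<omega> :: ('a \<Rightarrow> real) set)"
    using Lip_subset_VC_small by blast
  from C0_closure_mono[OF this] C0_closure_VC_small_subset
  show "C0_closure \<omega> (C1 \<alpha> \<inter> Lip \<inter> C0_dot \<omega>) \<subseteq> (VC_small \<omega> :: ('a \<Rightarrow> real) set)" by blast
  show "VC_small \<omega> \<subseteq> C0_closure \<omega> (C1 \<alpha> \<inter> Lip \<inter> C0_dot \<omega> :: ('a \<Rightarrow> real) set)"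
  proof
    fix f :: "'a \<Rightarrow> real" assume f: "f \<in> VC_small \<omega>"
    then have "f \<in> C0_dot \<omega>" by (simp add: VC_small_iff)
    then show "f \<in> C0_closure \<omega> (C1 \<alpha> \<inter> Lip \<inter> C0_dot \<omega>)"
      unfolding C0_closure_iff
    proof (intro conjI allI impI)
      fix e :: real assume "0 < e"
      from VC_small_regularization[OF assms f this]
      show "\<exists>g\<in>C1 \<alpha> \<inter> Lip \<inter> C0_dot \<omega>. \<forall>x y. x \<noteq> y \<longrightarrow> osc_le e (\<lambda>x. g x - f x) x y"
        by (elim exE conjE) (rule bexI)
    qed
  qed
qed

text \<open>Cut off first, then regularize, with error \<open>e / 2\<close> each: the cutoff need
  not be smooth, and regularization keeps the support bounded.\<close>

lemma C0_closure_C1_bs: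
  fixes P :: "'a::real_normed_vector \<Rightarrow> real"
  assumes \<alpha>: "0 < \<alpha>" and gauge: "smooth_gauge P (1 + \<alpha>) a C"
  shows "C0_closure \<omega> (C1_bs \<alpha>) = (VC \<omega> :: ('a \<Rightarrow> real) set)"
proof
  have "C1_bs \<alpha> \<subseteq> (VC \<omega> :: ('a \<Rightarrow> real) set)"
  proof
    fix f :: "'a \<Rightarrow> real" assume "f \<in> C1_bs \<alpha>"
    from C1_bs_Lip_bounded[OF \<alpha> this] obtain M R
      where "f \<in> Lip" "\<forall>x. \<bar>f x\<bar> \<le> M" "\<forall>x. x \<notin> ball 0 R \<longrightarrow> f x = 0" by blast
    then show "f \<in> VC \<omega>" by (intro bounded_support_in_VC[of f M R]) auto
  qed
  from C0_closure_mono[OF this] C0_closure_VC_subset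
  show "C0_closure \<omega> (C1_bs \<alpha>) \<subseteq> (VC \<omega> :: ('a \<Rightarrow> real) set)" by blast
  show "VC \<omega> \<subseteq> (C0_closure \<omega> (C1_bs \<alpha>) :: ('a \<Rightarrow> real) set)"
  proof
    fix f :: "'a \<Rightarrow> real" assume f: "f \<in> VC \<omega>"
    show "f \<in> C0_closure \<omega> (C1_bs \<alpha>)"
      unfolding C0_closure_iff
    proof (intro conjI allI impI)
      show "f \<in> C0_dot \<omega>" using f by (simp add: VC_def VC_small_def)
      fix e :: real assume "0 < e"
      then have e: "0 < e / 2" by simp
      from VC_cutoff[OF f e]
      obtain u where u: "u \<in> VC_small \<omega>" "\<exists>R. \<forall>x. x \<notin> ball 0 R \<longrightarrow> u x = 0"
        "\<forall>x y. x \<noteq> y \<longrightarrow> osc_le (e / 2) (\<lambda>x. u x - f x) x y"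
        by (elim bexE conjE)
      from VC_small_regularization[OF \<alpha> gauge u(1) e]
      obtain g where g: "g \<in> C1 \<alpha> \<inter> Lip \<inter> C0_dot \<omega>"
        "\<forall>x y. x \<noteq> y \<longrightarrow> osc_le (e / 2) (\<lambda>x. g x - u x) x y"
        "\<forall>R. (\<forall>x. x \<notin> ball 0 R \<longrightarrow> u x = 0) \<longrightarrow> (\<exists>R'. \<forall>x. x \<notin> ball 0 R' \<longrightarrow> g x = 0)"
        by (elim exE conjE)
      have "\<exists>R. \<forall>x. x \<notin> ball 0 R \<longrightarrow> g x = 0" using g(3) u(2) by blast
      with g(1) have "g \<in> C1_bs \<alpha>" by (simp add: C1_bs_def)
      moreover have "osc_le e (\<lambda>x. g x - f x) x y" if "x \<noteq> y" for x y
      proof -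
        have "osc_le (e / 2) (\<lambda>x. u x - f x) x y" "osc_le (e / 2) (\<lambda>x. g x - u x) x y"
          using u(3) g(2) that by blast+
        then show ?thesis unfolding osc_le_def by argo
      qed
      ultimately show "\<exists>g\<in>C1_bs \<alpha>. \<forall>x y. x \<noteq> y \<longrightarrow> osc_le e (\<lambda>x. g x - f x) x y" by blast
    qed
  qed
qed

end

theorem theorem1p4:
  fixes \<alpha> C_db :: real and \<omega> :: "real \<Rightarrow> real"
  assumes "0 < \<alpha>" and "\<alpha> \<le> 1"
    and "super_reflexive TYPE('a::banach)"
    and "smooth_renorming TYPE('a) \<alpha>"
    and "\<And>t. t > 0 \<Longrightarrow> \<omega> t > 0"
    and "mono_on {0<..} \<omega>"
    and "(\<omega> \<longlongrightarrow> 0) (at_right 0)"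
    and "filterlim \<omega> at_top at_top"
    and "((\<lambda>t. t / \<omega> t) \<longlongrightarrow> 0) (at_right 0)"
    and "C_db > 1"
    and "\<And>t. t > 0 \<Longrightarrow> \<omega> (2 * t) \<le> C_db * \<omega> t"
  shows "C0_closure \<omega> (C1 \<alpha> \<inter> Lip \<inter> C0_dot \<omega>) = (VC_small \<omega> :: ('a \<Rightarrow> real) set)
       \<and> C0_closure \<omega> (C1_bs \<alpha>) = (VC \<omega> :: ('a \<Rightarrow> real) set)"
proof -
  interpret modulus \<omega> by unfold_locales (use assms(5,6,8,9) in auto)
  obtain P :: "'a \<Rightarrow> real" and a C where "smooth_gauge P (1 + \<alpha>) a C"
    using smooth_renorming_imp_smooth_gauge[OF assms(4,1)] by blast
  then show ?thesis using C0_closure_C1_Lip C0_closure_C1_bs assms(1) by blast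
qed

end
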